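(* Let $(M,d)$ be a metric space and let $Y$ be a bounded subset of $M$. Let $\mathcal{N}$ be a $\sigma$-algebra of subsets of $Y$ containing all Borel subsets of $Y$, and let $\nu$ be a measure on $\mathcal{N}$ such that $\nu(B(x,r)\cap Y)<+\infty$ for all $x\in Y$, $r>0$. Let $\upsilon_Y\in]0,+\infty[$ and assume that $Y$ is upper $\upsilon_Y$-Ahlfors regular with respect to $Y$. Let $s_1,t_1\in[0,\upsilon_Y[$, $s_3\in[0,+\infty[$, $s_2'\in[0,\upsilon_Y[$, $s_2''\in[0,s_3]$ and $s_2\equiv s_2'+s_2''$. If $s_1+t_1=\upsilon_Y$ or $s_2'+t_1=\upsilon_Y$, assume furthermore that $Y$ is strongly upper $\upsilon_Y$-Ahlfors regular with respect to $Y$. Let $K_1\in\mathcal{K}_{s_1,s_2,s_3}(Y\times Y)$, $K_2\in\mathcal{K}_{t_1,Y\times Y}$, and let $K_3(x,y)\equiv\int_Y K_1(x,t)K_2(t,y)\,d\nu(t)$ for $x,y\in Y$, $x\neq y$. Set $m\equiv\min\{s_3-s_2'',\upsilon_Y-s_1,\upsilon_Y-t_1\}$ and, for $\epsilon\in]0,+\infty[$, \[ a_1(\epsilon)\equiv\begin{cases}0&\text{if } s_1+t_1<\upsilon_Y,\\ \epsilon&\text{if } s_1+t_1=\upsilon_Y,\\ s_1+t_1-\upsilon_Y&\text{if } s_1+t_1>\upsilon_Y,\end{cases}\qquad a_2(\epsilon)\equiv\begin{cases}\max\{s_1,t_1\}&\text{if } s_2'+t_1<\upsilon_Y,\\ \max\{\epsilon,s_1,t_1\}&\text{if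 } s_2'+t_1=\upsilon_Y,\\ \max\{s_2'+t_1-\upsilon_Y,s_1,t_1\}&\text{if } s_2'+t_1>\upsilon_Y.\end{cases} \] Then $K_3\in\mathcal{K}_{a_1(\epsilon),a_2(\epsilon),m}(Y\times Y)$ for every $\epsilon\in]0,+\infty[$ (in the cases where neither $a_1$ nor $a_2$ involves $\epsilon$, this is a single class).
   Context: For $\xi\in M$, $r>0$, $B(\xi,r)=\{\eta\in M: d(\xi,\eta)<r\}$, and $B(\xi,0)=\emptyset$. $Y$ is upper $\upsilon$-Ahlfors regular with respect to $Y$ if there exist $r_0\in]0,+\infty]$, $c_0\in]0,+\infty[$ with $\nu(B(x,r)\cap Y)\leq c_0r^{\upsilon}$ for all $x\in Y$, $r\in]0,r_0[$; strongly upper $\upsilon$-Ahlfors regular with respect to $Y$ if there exist $r_0\in]0,+\infty]$, $c_0\in]0,+\infty[$ with $\nu((B(x,r_2)\setminus B(x,r_1))\cap Y)\leq c_0(r_2^{\upsilon}-r_1^{\upsilon})$ for all $x\in Y$, $r_1,r_2\in[0,r_0[$, $r_1<r_2$. For $s\in\mathbb{R}$, $\mathcal{K}_{s,Y\times Y}$ is the set of continuous $K:\{(x,y)\in Y^2: x\neq y\}\to\mathbb{C}$ with $\sup_{x\neq y}|K(x,y)|d(x,y)^s<+\infty$. For $a_1,a_2,a_3\in\mathbb{R}$, $\mathcal{K}_{a_1,a_2,a_3}(Y\times Y)$ is the set of continuous $K:\{(x,y)\in Y^2:x\neq y\}\to\mathbb{C}$ such that $\sup\{d(x,y)^{a_1}|K(x,y)|: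 x,y\in Y,x\neq y\}<+\infty$ and $\sup\{\frac{d(x',y)^{a_2}}{d(x',x'')^{a_3}}|K(x',y)-K(x'',y)|: x',x''\in Y, x'\neq x'', y\in Y\setminus B(x',2d(x',x''))\}<+\infty$. *)

theory Defs
  imports "HOL-Analysis.Analysis"
begin

text \<open>Balls: for r > 0, B(x,r) = ball x r; and ball x 0 = {} as in the paper.
  The metric space (M,d) is the type 'a with its metric dist.\<close>

definition upper_ahlfors_regular :: "'a::metric_space measure \<Rightarrow> 'a set \<Rightarrow> real \<Rightarrow> bool" where
  "upper_ahlfors_regular nu Y v \<longleftrightarrow>
    (\<exists>r0::ereal. \<exists>c0::real. 0 < r0 \<and> 0 < c0 \<and>
      (\<forall>x\<in>Y. \<forall>r. 0 < r \<and> ereal r < r0 \<longrightarrow>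
          emeasure nu (ball x r \<inter> Y) \<le> ennreal (c0 * r powr v)))"

definition strongly_upper_ahlfors_regular :: "'a::metric_space measure \<Rightarrow> 'a set \<Rightarrow> real \<Rightarrow> bool" where
  "strongly_upper_ahlfors_regular nu Y v \<longleftrightarrow>
    (\<exists>r0::ereal. \<exists>c0::real. 0 < r0 \<and> 0 < c0 \<and>
      (\<forall>x\<in>Y. \<forall>r1 r2. 0 \<le> r1 \<and> ereal r1 < r0 \<and> 0 \<le> r2 \<and> ereal r2 < r0 \<and> r1 < r2 \<longrightarrow>
          emeasure nu ((ball x r2 - ball x r1) \<inter> Y) \<le> ennreal (c0 * (r2 powr v - r1 powr v))))"

definition offdiag_continuous :: "'a::metric_space set \<Rightarrow> ('a \<Rightarrow> 'a \<Rightarrow> complex) \<Rightarrow> bool" where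
  "offdiag_continuous Y K \<longleftrightarrow>
     continuous_on {(x, y). x \<in> Y \<and> y \<in> Y \<and> x \<noteq> y} (\<lambda>(x, y). K x y)"

definition kernel_class :: "'a::metric_space set \<Rightarrow> real \<Rightarrow> ('a \<Rightarrow> 'a \<Rightarrow> complex) set" where
  "kernel_class Y s = {K. offdiag_continuous Y K \<and>
     (\<exists>C. \<forall>x\<in>Y. \<forall>y\<in>Y. x \<noteq> y \<longrightarrow> norm (K x y) * dist x y powr s \<le> C)}"

definition kernel_class3 :: "'a::metric_space set \<Rightarrow> real \<Rightarrow> real \<Rightarrow> real \<Rightarrow> ('a \<Rightarrow> 'a \<Rightarrow> complex) set" where
  "kernel_class3 Y a1 a2 a3 = {K. offdiag_continuous Y K \<and>
     (\<exists>C. \<forall>x\<in>Y. \<forall>y\<in>Y. x \<noteq> y \<longrightarrow> dist x y powr a1 * norm (K x y) \<le> C) \<and>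
     (\<exists>C. \<forall>x'\<in>Y. \<forall>x''\<in>Y. \<forall>y\<in>Y. x' \<noteq> x'' \<and> y \<notin> ball x' (2 * dist x' x'') \<longrightarrow>
         dist x' y powr a2 / dist x' x'' powr a3 * norm (K x' y - K x'' y) \<le> C)}"

end

theory Submission
  imports Defs
begin

text \<open>
  After rescaling the constant, the regularity estimate \<open>\<nu>(B(x,r) \<inter> Y) \<le> c r^v\<close> holds for all
  radii, and summing it over dyadic shells bounds the integral of \<open>d(x,\<cdot>)^(-s)\<close> over a ball when
  \<open>s < v\<close> and over the complement of a ball when \<open>s > v\<close>. Splitting \<open>Y\<close> into balls of radius
  \<open>d(x,y)/2\<close> about \<open>x\<close> and \<open>y\<close> and the remainder, where
  \<open>d(x,t)^(-s) d(t,y)^(-u) \<le> d(x,t)^(-s-u) + d(t,y)^(-s-u)\<close>, gives the size estimate.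
  For the increment between \<open>x'\<close> and \<open>x''\<close>, the ball of radius \<open>2 d(x',x'')\<close> about \<open>x'\<close> is
  handled by size alone; outside it the Hoelder-type bound on \<open>K1\<close> applies, and
  \<open>d(x',t)^(-s2'')\<close> is traded against \<open>d(x',x'')^(-s2'')\<close>. Off-diagonal continuity is dominated
  convergence away from small balls about the two poles, whose contribution is uniformly small.
\<close>

section \<open>Elementary inequalities for powers, dyadic brackets and integrals\<close>

text \<open>On a bounded range a larger exponent can be traded for a smaller one at the price of a
  constant. This is how exponents that are not sharp, or critical, are absorbed later on.\<close>

lemma powr_le_of_bounded:
  fixes x D p q :: real
  assumes "0 < x" "x \<le> D" "p \<le> q"
  shows "x powr q \<le> D powr (q - p) * x powr p"
proof -
  have "x powr q = x powr (q - p) * x powr p"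
    using assms by (simp flip: powr_add)
  also have "\<dots> \<le> D powr (q - p) * x powr p"
    using assms by (intro mult_right_mono powr_mono2) auto
  finally show ?thesis .
qed

lemma powr_neg_antimono:
  fixes a b s :: real
  assumes "0 < a" "a \<le> b" "0 \<le> s"
  shows "b powr (-s) \<le> a powr (-s)"
  using assms powr_mono2'[of "-s" a b] by simp

text \<open>The smaller of the two bases gives the larger negative power, so replacing the other
  base by it merges the exponents. This decouples the two poles.\<close>

lemma powr_neg_mult_le:
  fixes a b s u :: real
  assumes "0 \<le> a" "0 \<le> b" "0 \<le> s" "0 \<le> u"
  shows "a powr (-s) * b powr (-u) \<le> a powr (-(s+u)) + b powr (-(s+u))"
proof -
  \<comment> \<open>Since \<open>0 powr p = 0\<close>, the left side vanishes when a base is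
    zero.\<close>
  consider "a = 0" | "b = 0" | "0 < a" "a \<le> b" | "0 < b" "b \<le> a"
    using assms by linarith
  then show ?thesis
  proof cases
    case 3
    then have "a powr (-s) * b powr (-u) \<le> a powr (-s) * a powr (-u)"
      using assms by (intro mult_left_mono powr_neg_antimono) auto
    also have "\<dots> = a powr (-(s+u))" by (simp flip: powr_add)
    finally show ?thesis by (simp add: add_increasing2)
  next
    case 4
    then have "a powr (-s) * b powr (-u) \<le> b powr (-s) * b powr (-u)"
      using assms by (intro mult_right_mono powr_neg_antimono) auto
    also have "\<dots> = b powr (-(s+u))" by (simp flip: powr_add)
    finally show ?thesis by (simp add: add_increasing)
  qed auto
qed

text \<open>\<open>k\<close> is the last index at which the lower bound still holds. The two
  versions differ in which inequality is strict: the first suits complements of open balls, the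
  second open balls.\<close>

lemma ex_dyadic:
  fixes x :: real
  shows "1 \<le> x \<Longrightarrow> \<exists>k. 2 ^ k \<le> x \<and> x < 2 * 2 ^ k"
    and "1 < x \<Longrightarrow> \<exists>k. 2 ^ k < x \<and> x \<le> 2 * 2 ^ k"
proof -
  have drop: "\<exists>k. P k \<and> \<not> P (Suc k)" if "P 0" "\<not> P n" for P :: "nat \<Rightarrow> bool" and n
    using that by (metis nat_induct)
  obtain n where n: "x < 2 ^ n" using real_arch_pow[of 2 x] by auto
  show "1 \<le> x \<Longrightarrow> \<exists>k. 2 ^ k \<le> x \<and> x < 2 * 2 ^ k"
    using drop[of "\<lambda>k. 2 ^ k \<le> x" n] n by (auto simp: not_le)
  show "1 < x \<Longrightarrow> \<exists>k. 2 ^ k < x \<and> x \<le> 2 * 2 ^ k"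
    using drop[of "\<lambda>k. 2 ^ k < x" n] n by (auto simp: not_less)
qed

text \<open>Lets the later estimates supply just a pointwise inequality and two integral bounds,
  with all constants kept real.\<close>

lemma nn_integral_le_two:
  assumes "\<And>t. t \<in> space M \<Longrightarrow> f t \<le> ennreal A * g t + ennreal B * h t"
    and [measurable]: "g \<in> borel_measurable M" "h \<in> borel_measurable M"
    and "(\<integral>\<^sup>+t. g t \<partial>M) \<le> ennreal G" "(\<integral>\<^sup>+t. h t \<partial>M) \<le> ennreal H"
    and "0 \<le> A" "0 \<le> B" "0 \<le> G" "0 \<le> H"
  shows "(\<integral>\<^sup>+t. f t \<partial>M) \<le> ennreal (A * G + B * H)"
proof -
  have "(\<integral>\<^sup>+t. f t \<partial>M) \<le> (\<integral>\<^sup>+t. ennreal A * g t + ennreal B * h t \<partial>M)"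
    by (intro nn_integral_mono assms)
  also have "\<dots> = ennreal A * (\<integral>\<^sup>+t. g t \<partial>M) + ennreal B * (\<integral>\<^sup>+t. h t \<partial>M)"
    by (simp add: nn_integral_add nn_integral_cmult)
  also have "\<dots> \<le> ennreal A * ennreal G + ennreal B * ennreal H"
    by (intro add_mono mult_left_mono assms) auto
  also have "\<dots> = ennreal (A * G + B * H)"
    using assms by (simp add: ennreal_mult)
  finally show ?thesis .
qed

section \<open>Measurability, null points and finiteness from the ball estimate\<close>

text \<open>The ball estimate is for all radii, without a threshold. \<open>D\<close> bounds the
  diameter and is at least 1 so that \<open>D powr e\<close> increases with
  \<open>e\<close>.\<close>

locale bounded_ahlfors =
  fixes Y :: "'a::metric_space set" and nu :: "'a measure" and v c D :: real
  assumes space_nu: "space nu = Y"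
    and borel_sub: "sets (restrict_space borel Y) \<subseteq> sets nu"
    and v_pos: "0 < v" and c_pos: "0 < c" and D_ge: "1 \<le> D"
    and dist_le: "\<And>x y. x \<in> Y \<Longrightarrow> y \<in> Y \<Longrightarrow> dist x y \<le> D"
    and ball_le: "\<And>x r. x \<in> Y \<Longrightarrow> 0 < r \<Longrightarrow>
          emeasure nu (ball x r \<inter> Y) \<le> ennreal (c * r powr v)"
begin

lemma sets_nu: "B \<in> sets borel \<Longrightarrow> B \<inter> Y \<in> sets nu"
  using borel_sub by (auto simp: sets_restrict_space)

lemma borel_measurable_nu:
  assumes "f \<in> measurable borel N"
  shows "f \<in> measurable nu N"
proof (rule measurableI)
  fix A assume "A \<in> sets N"
  then have "f -` A \<in> sets borel" using measurable_sets[OF assms] by simp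
  then show "f -` A \<inter> space nu \<in> sets nu" by (simp add: space_nu sets_nu)
qed (use measurable_space[OF assms] in auto)

lemma dist_measurable [measurable]:
  "(\<lambda>t. dist x t) \<in> borel_measurable nu" "(\<lambda>t. dist t x) \<in> borel_measurable nu"
  by (intro borel_measurable_nu borel_measurable_continuous_onI continuous_intros)+

lemma indicator_measurable [measurable]:
  fixes A :: "'a set"
  assumes "A \<in> sets borel"
  shows "(indicator A :: 'a \<Rightarrow> ennreal) \<in> borel_measurable nu"
    and "(indicator A :: 'a \<Rightarrow> real) \<in> borel_measurable nu"
  using assms by (auto intro!: borel_measurable_nu)

text \<open>Kernels have arbitrary values on the diagonal, so an integrand is continuous only off
  its poles \<open>S\<close>. The preimage of an open set differs from a relatively open one by
  finitely many points, and these form a closed set.\<close>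

lemma measurable_continuous_off_finite:
  fixes g :: "'a \<Rightarrow> 'b::{second_countable_topology, t2_space}"
  assumes "finite S" "continuous_on (Y - S) g"
  shows "g \<in> borel_measurable nu"
proof (rule borel_measurableI)
  fix U :: "'b set" assume "open U"
  then obtain V where V: "open V" "V \<inter> (Y - S) = g -` U \<inter> (Y - S)"
    using assms(2) unfolding continuous_on_open_invariant by blast
  have "finite (g -` U \<inter> Y \<inter> S)" using assms(1) by auto
  then have "((V - S) \<union> (g -` U \<inter> Y \<inter> S)) \<inter> Y \<in> sets nu"
    using V(1) assms(1) by (intro sets_nu sets.Un sets.Diff) (auto intro: finite_imp_closed borel_closed)
  moreover have "((V - S) \<union> (g -` U \<inter> Y \<inter> S)) \<inter> Y = g -` U \<inter> space nu"
    using V(2) by (auto simp: space_nu)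
  ultimately show "g -` U \<inter> space nu \<in> sets nu" by simp
qed

text \<open>The ball bound tends to 0 with the radius, so points carry no mass. Hence the values of
  kernels on the diagonal do not influence the integrals.\<close>

lemma AE_neq:
  assumes "x \<in> Y"
  shows "AE t in nu. t \<noteq> x"
proof -
  have "emeasure nu {x} \<le> ennreal e" if "e > 0" for e
  proof -
    define r where "r = (e / c) powr (1 / v)"
    have r: "r > 0" "c * r powr v = e"
      using that c_pos v_pos by (auto simp: r_def powr_powr)
    have "emeasure nu {x} \<le> emeasure nu (ball x r \<inter> Y)"
      using assms r by (intro emeasure_mono sets_nu) auto
    also have "\<dots> \<le> ennreal (c * r powr v)" using ball_le[OF assms r(1)] .
    finally show ?thesis using r by simp
  qed
  then have "emeasure nu {x} = 0"
    by (metis ennreal_le_epsilon add.left_neutral le_zero_eq)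
  then show ?thesis
    using sets_nu[of "{x}"] assms by (intro AE_I[of _ _ "{x}"]) auto
qed

lemma finite_measure_nu: "finite_measure nu"
proof (cases "Y = {}")
  case True
  then show ?thesis by (intro finite_measureI) (simp add: space_nu)
next
  case False
  then obtain x where x: "x \<in> Y" by auto
  have "ball x (D + 1) \<inter> Y = Y" using dist_le[OF x] by force
  moreover have "emeasure nu (ball x (D + 1) \<inter> Y) \<le> ennreal (c * (D + 1) powr v)"
    using ball_le[OF x] D_ge by simp
  ultimately show ?thesis
    by (intro finite_measureI) (auto simp: space_nu top_unique)
qed

section \<open>Integrals of one power of the distance, inside and outside a ball\<close>

text \<open>On the shell of inner radius \<open>r * q ^ k\<close> the integrand is at most that
  radius to the power \<open>-s\<close>, and the shell sits in a ball of twice the radius. The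
  products form a geometric series of ratio \<open>q powr (v - s)\<close>. Taking
  \<open>q = 1/2\<close> serves balls (\<open>s < v\<close>), and \<open>q = 2\<close> serves
  complements of balls (\<open>v < s\<close>).\<close>

lemma nn_integral_shells_le:
  assumes x: "x \<in> Y" and r: "0 < r" and q: "0 < q" "q powr (v - s) < 1" and s: "0 \<le> s"
    and cover: "\<And>t. t \<in> A \<Longrightarrow> t \<in> Y \<Longrightarrow> t \<noteq> x \<Longrightarrow>
       \<exists>k::nat. r * q ^ k \<le> dist x t \<and> dist x t < 2 * (r * q ^ k)"
  shows "(\<integral>\<^sup>+t. ennreal (dist x t powr (-s)) * indicator A t \<partial>nu)
      \<le> ennreal (c * 2 powr v / (1 - q powr (v - s)) * r powr (v - s))"
proof -
  define R where "R k = r * q ^ k" for k :: nat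
  have R: "R k > 0" for k using r q by (simp add: R_def)
  \<comment> \<open>The whole ball replaces the shell, because \<open>ball_le\<close> measures
    balls.\<close>
  define f where "f k t = ennreal (R k powr (-s)) * indicator (ball x (2 * R k) \<inter> Y) t" for k t
  have B: "ball x (2 * R k) \<inter> Y \<in> sets nu" for k by (intro sets_nu) simp
  have "(\<integral>\<^sup>+t. ennreal (dist x t powr (-s)) * indicator A t \<partial>nu) \<le> (\<integral>\<^sup>+t. (\<Sum>k. f k t) \<partial>nu)"
  proof (rule nn_integral_mono)
    fix t assume "t \<in> space nu"
    then have tY: "t \<in> Y" by (simp add: space_nu)
    \<comment> \<open>At the pole \<open>t = x\<close> the left side is 0 by
      \<open>0 powr (-s) = 0\<close>, so no shell has to contain it.\<close>
    show "ennreal (dist x t powr (-s)) * indicator A t \<le> (\<Sum>k. f k t)"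
    proof (cases "t \<in> A \<and> t \<noteq> x")
      case True
      then obtain k where k: "R k \<le> dist x t" "dist x t < 2 * R k"
        using cover tY unfolding R_def by blast
      have "ennreal (dist x t powr (-s)) * indicator A t \<le> f k t"
        using k True tY s R[of k] by (auto simp: f_def intro!: ennreal_leI powr_neg_antimono)
      also have "\<dots> \<le> (\<Sum>k. f k t)"
        using sum_le_suminf[of "\<lambda>k. f k t" "{k}"] by (simp add: summableI)
      finally show ?thesis .
    qed (auto simp: indicator_def)
  qed
  also have "\<dots> = (\<Sum>k. \<integral>\<^sup>+t. f k t \<partial>nu)"
    using B by (intro nn_integral_suminf) (auto simp: f_def)
  also have "\<dots> = (\<Sum>k. ennreal (R k powr (-s)) * emeasure nu (ball x (2 * R k) \<inter> Y))"
    unfolding f_def using B by (simp add: nn_integral_cmult_indicator)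
  also have "\<dots> \<le> (\<Sum>k. ennreal (c * 2 powr v * r powr (v - s) * (q powr (v - s)) ^ k))"
  proof (intro suminf_le summableI)
    fix k
    have "ennreal (R k powr (-s)) * emeasure nu (ball x (2 * R k) \<inter> Y)
        \<le> ennreal (R k powr (-s)) * ennreal (c * (2 * R k) powr v)"
      using ball_le[OF x, of "2 * R k"] R[of k] by (intro mult_left_mono) auto
    also have "\<dots> = ennreal (R k powr (-s) * (c * (2 * R k) powr v))"
      using c_pos by (simp add: ennreal_mult)
    also have "R k powr (-s) * (c * (2 * R k) powr v) = c * 2 powr v * R k powr (v - s)"
      using R[of k] by (simp add: powr_mult powr_diff powr_minus field_simps)
    also have "R k powr (v - s) = r powr (v - s) * (q powr (v - s)) ^ k"
      unfolding R_def using r q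
      by (simp add: powr_mult powr_powr mult.commute flip: powr_realpow)
    finally show "ennreal (R k powr (-s)) * emeasure nu (ball x (2 * R k) \<inter> Y)
        \<le> ennreal (c * 2 powr v * r powr (v - s) * (q powr (v - s)) ^ k)"
      by (simp add: mult.assoc)
  qed
  also have "\<dots> = ennreal (c * 2 powr v * r powr (v - s) * (1 / (1 - q powr (v - s))))"
    using q c_pos
    by (intro suminf_ennreal_eq sums_mult geometric_sums) auto
  finally show ?thesis by simp
qed

lemma nn_integral_near:
  assumes s: "0 \<le> s" "s < v"
  obtains C where "C > 0" and "\<And>x r. x \<in> Y \<Longrightarrow> 0 < r \<Longrightarrow>
    (\<integral>\<^sup>+t. ennreal (dist x t powr (-s)) * indicator (ball x r) t \<partial>nu)
      \<le> ennreal (C * r powr (v - s))"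
proof -
  let ?q = "(1/2) powr (v - s) :: real"
  have q: "?q < 1" using s by (simp add: powr01_less_one)
  \<comment> \<open>The last factor comes from starting the shells at inner radius
    \<open>r / 2\<close>, so that the outermost one ends at \<open>r\<close>.\<close>
  define C where "C = c * 2 powr v / (1 - ?q) * (1/2) powr (v - s)"
  show thesis
  proof (rule that[of C])
    show "C > 0" using q c_pos by (simp add: C_def)
    fix x r assume x: "x \<in> Y" and r: "0 < (r::real)"
    have "(\<integral>\<^sup>+t. ennreal (dist x t powr (-s)) * indicator (ball x r) t \<partial>nu)
      \<le> ennreal (c * 2 powr v / (1 - ?q) * (r / 2) powr (v - s))"
    proof (rule nn_integral_shells_le[OF x])
      fix t assume t: "t \<in> ball x r" "t \<noteq> x"
      then have "1 < r / dist x t" by auto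
      then obtain k :: nat where k: "2 ^ k < r / dist x t" "r / dist x t \<le> 2 * 2 ^ k"
        using ex_dyadic(2) by blast
      have "r / 2 * (1/2) ^ k \<le> dist x t" "dist x t < 2 * (r / 2 * (1/2) ^ k)"
        using k t by (auto simp: field_simps power_divide)
      then show "\<exists>k. r / 2 * (1/2) ^ k \<le> dist x t \<and> dist x t < 2 * (r / 2 * (1/2) ^ k)"
        by blast
    qed (use s q r in auto)
    also have "(r / 2) powr (v - s) = (1/2) powr (v - s) * r powr (v - s)"
      using r by (simp add: powr_divide powr_one_eq_one)
    finally show "(\<integral>\<^sup>+t. ennreal (dist x t powr (-s)) * indicator (ball x r) t \<partial>nu)
      \<le> ennreal (C * r powr (v - s))" by (simp add: C_def mult.assoc)
  qed
qed

lemma nn_integral_far_supercritical: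
  assumes s: "v < s"
  obtains C where "C > 0" and "\<And>x r. x \<in> Y \<Longrightarrow> 0 < r \<Longrightarrow>
    (\<integral>\<^sup>+t. ennreal (dist x t powr (-s)) * indicator (- ball x r) t \<partial>nu)
      \<le> ennreal (C * r powr (v - s))"
proof -
  let ?q = "2 powr (v - s) :: real"
  have q: "?q < 1" using s by (simp add: powr_less_one)
  show thesis
  proof (rule that[of "c * 2 powr v / (1 - ?q)"])
    show "c * 2 powr v / (1 - ?q) > 0" using q c_pos by simp
    fix x r assume x: "x \<in> Y" and r: "0 < (r::real)"
    show "(\<integral>\<^sup>+t. ennreal (dist x t powr (-s)) * indicator (- ball x r) t \<partial>nu)
      \<le> ennreal (c * 2 powr v / (1 - ?q) * r powr (v - s))"
    proof (rule nn_integral_shells_le[OF x r])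
      fix t assume t: "t \<in> - ball x r" "t \<noteq> x"
      then have "1 \<le> dist x t / r" using r by auto
      then obtain k :: nat where k: "2 ^ k \<le> dist x t / r" "dist x t / r < 2 * 2 ^ k"
        using ex_dyadic(1) by blast
      have "r * 2 ^ k \<le> dist x t" "dist x t < 2 * (r * 2 ^ k)"
        using k r by (auto simp: field_simps)
      then show "\<exists>k. r * 2 ^ k \<le> dist x t \<and> dist x t < 2 * (r * 2 ^ k)"
        by blast
    qed (use s q v_pos in auto)
  qed
qed

text \<open>In the critical case \<^term>\<open>s = v\<close> the logarithm is absorbed by any \<^term>\<open>a > 0\<close>:
  on a bounded set \<^term>\<open>dist x t powr (-v)\<close> is dominated by
  \<^term>\<open>dist x t powr (-(v + a))\<close>.\<close>

lemma nn_integral_far: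
  assumes s: "0 \<le> s" and a: "0 \<le> a" "s - v \<le> a" "s = v \<Longrightarrow> 0 < a"
  obtains C where "C > 0" and "\<And>x r. x \<in> Y \<Longrightarrow> 0 < r \<Longrightarrow> r \<le> D \<Longrightarrow>
    (\<integral>\<^sup>+t. ennreal (dist x t powr (-s)) * indicator (- ball x r) t \<partial>nu)
      \<le> ennreal (C * r powr (-a))"
proof (cases "s < v")
  case True
  obtain C where C: "C > 0" "\<And>x r. x \<in> Y \<Longrightarrow> 0 < r \<Longrightarrow>
    (\<integral>\<^sup>+t. ennreal (dist x t powr (-s)) * indicator (ball x r) t \<partial>nu)
      \<le> ennreal (C * r powr (v - s))"
    using nn_integral_near[OF s True] by blast
  show thesis
  \<comment> \<open>For \<open>s < v\<close> the integral over all of \<open>Y\<close>, which lies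
    in \<open>ball x (2 * D)\<close>, is already finite. The factor \<open>r powr (-a)\<close> is
    inserted through \<open>1 \<le> D powr a * r powr (-a)\<close>, valid as
    \<open>r \<le> D\<close>.\<close>
  proof (rule that[of "C * (2 * D) powr (v - s) * D powr a"])
    show "C * (2 * D) powr (v - s) * D powr a > 0" using C D_ge by simp
    fix x r assume x: "x \<in> Y" and r: "0 < r" "r \<le> D"
    have "(\<integral>\<^sup>+t. ennreal (dist x t powr (-s)) * indicator (- ball x r) t \<partial>nu)
      \<le> (\<integral>\<^sup>+t. ennreal (dist x t powr (-s)) * indicator (ball x (2 * D)) t \<partial>nu)"
    proof (rule nn_integral_mono)
      fix t assume "t \<in> space nu"
      then have "t \<in> ball x (2 * D)" using dist_le[OF x, of t] D_ge by (auto simp: space_nu)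
      then show "ennreal (dist x t powr (-s)) * indicator (- ball x r) t
        \<le> ennreal (dist x t powr (-s)) * indicator (ball x (2 * D)) t"
        by (auto simp: indicator_def)
    qed
    also have "\<dots> \<le> ennreal (C * (2 * D) powr (v - s))" using C(2)[OF x, of "2 * D"] D_ge by simp
    also have "\<dots> \<le> ennreal (C * (2 * D) powr (v - s) * (D powr a * r powr (-a)))"
    proof (rule ennreal_leI)
      have "1 \<le> D powr a * r powr (-a)"
        using powr_le_of_bounded[of r D "-a" 0] r a by simp
      then show "C * (2 * D) powr (v - s)
          \<le> C * (2 * D) powr (v - s) * (D powr a * r powr (-a))"
        using C D_ge by (metis mult_left_mono mult.right_neutral less_imp_le zero_le_mult_iff powr_ge_zero)
    qed
    finally show "(\<integral>\<^sup>+t. ennreal (dist x t powr (-s)) * indicator (- ball x r) t \<partial>nu)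
      \<le> ennreal (C * (2 * D) powr (v - s) * D powr a * r powr (-a))" by (simp add: mult.assoc)
  qed
next
  case False
  \<comment> \<open>Here \<open>a > 0\<close>: by assumption if \<open>s = v\<close>, and from
    \<open>s - v \<le> a\<close> if \<open>s > v\<close>. So \<open>v + a\<close> is supercritical
    and at least \<open>s\<close>; passing to it costs the constant \<open>E\<close> below.\<close>
  with a have "v < v + a" by (cases "s = v") auto
  from nn_integral_far_supercritical[OF this]
  obtain C where C: "C > 0" "\<And>x r. x \<in> Y \<Longrightarrow> 0 < r \<Longrightarrow>
    (\<integral>\<^sup>+t. ennreal (dist x t powr (-(v + a))) * indicator (- ball x r) t \<partial>nu)
      \<le> ennreal (C * r powr (v - (v + a)))"
    by blast
  define E where "E = D powr (v + a - s)"
  have E: "E > 0" using D_ge by (simp add: E_def)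
  show thesis
  proof (rule that[of "E * C"])
    show "E * C > 0" using C E by simp
    fix x r assume x: "x \<in> Y" and r: "0 < r" "r \<le> D"
    have "(\<integral>\<^sup>+t. ennreal (dist x t powr (-s)) * indicator (- ball x r) t \<partial>nu)
      \<le> (\<integral>\<^sup>+t. ennreal E * (ennreal (dist x t powr (-(v + a))) * indicator (- ball x r) t) \<partial>nu)"
    proof (rule nn_integral_mono)
      fix t assume "t \<in> space nu"
      then have t: "t \<in> Y" by (simp add: space_nu)
      have "dist x t powr (-s) \<le> E * dist x t powr (-(v + a))" if "t \<notin> ball x r"
        using powr_le_of_bounded[of "dist x t" D "-(v + a)" "-s"] dist_le[OF x t] a that r
        by (fastforce simp: E_def algebra_simps)
      then show "ennreal (dist x t powr (-s)) * indicator (- ball x r) t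
        \<le> ennreal E * (ennreal (dist x t powr (-(v + a))) * indicator (- ball x r) t)"
        using E by (auto simp: indicator_def simp flip: ennreal_mult intro!: ennreal_leI)
    qed
    also have "\<dots> = ennreal E * (\<integral>\<^sup>+t. ennreal (dist x t powr (-(v + a))) * indicator (- ball x r) t \<partial>nu)"
      by (rule nn_integral_cmult) measurable
    also have "\<dots> \<le> ennreal E * ennreal (C * r powr (v - (v + a)))"
      using C(2)[OF x r(1)] by (intro mult_left_mono) auto
    also have "\<dots> = ennreal (E * C * r powr (-a))"
      using E C by (simp add: mult.assoc flip: ennreal_mult)
    finally show "(\<integral>\<^sup>+t. ennreal (dist x t powr (-s)) * indicator (- ball x r) t \<partial>nu)
      \<le> ennreal (E * C * r powr (-a))" .
  qed
qed

section \<open>Integrals of a product of two powers with different poles\<close>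

text \<open>Every point is at distance at least half of \<open>dist x y\<close> from one of the two
  poles, and the factor of that pole can be frozen there. The remaining factor is integrated by
  \<open>nn_integral_near\<close>. The radius is unrestricted, so the ball may contain
  \<open>y\<close>.\<close>

lemma nn_integral_product_ball:
  assumes s: "0 \<le> s" "s < v" and u: "0 \<le> u" "u < v"
  obtains C where "C > 0" and "\<And>x y r. x \<in> Y \<Longrightarrow> y \<in> Y \<Longrightarrow> x \<noteq> y \<Longrightarrow> 0 < r \<Longrightarrow>
    (\<integral>\<^sup>+t. ennreal (dist x t powr (-s) * dist t y powr (-u)) * indicator (ball x r) t \<partial>nu)
      \<le> ennreal (C * (dist x y powr (-u) * r powr (v - s) + dist x y powr (-s) * r powr (v - u)))"
proof -
  obtain C1 where C1: "C1 > 0" "\<And>x r. x \<in> Y \<Longrightarrow> 0 < r \<Longrightarrow>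
    (\<integral>\<^sup>+t. ennreal (dist x t powr (-s)) * indicator (ball x r) t \<partial>nu)
      \<le> ennreal (C1 * r powr (v - s))"
    using nn_integral_near[OF s] by blast
  obtain C2 where C2: "C2 > 0" "\<And>x r. x \<in> Y \<Longrightarrow> 0 < r \<Longrightarrow>
    (\<integral>\<^sup>+t. ennreal (dist x t powr (-u)) * indicator (ball x r) t \<partial>nu)
      \<le> ennreal (C2 * r powr (v - u))"
    using nn_integral_near[OF u] by blast
  \<comment> \<open>The powers of 2 come from freezing a factor at distance
    \<open>dist x y / 2\<close>.\<close>
  define C where "C = 2 powr u * C1 + 2 powr s * C2"
  show thesis
  proof (rule that[of C])
    show "C > 0" using C1 C2 by (simp add: C_def add_pos_pos)
    fix x y r assume x: "x \<in> Y" and y: "y \<in> Y" and "x \<noteq> y" and r: "0 < (r::real)"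
    define \<rho> where "\<rho> = dist x y"
    have \<rho>: "\<rho> > 0" using \<open>x \<noteq> y\<close> by (simp add: \<rho>_def)
    have "(\<integral>\<^sup>+t. ennreal (dist x t powr (-s) * dist t y powr (-u)) * indicator (ball x r) t \<partial>nu)
      \<le> ennreal ((\<rho>/2) powr (-u) * (C1 * r powr (v - s)) + (\<rho>/2) powr (-s) * (C2 * r powr (v - u)))"
    proof (rule nn_integral_le_two[OF _ _ _ C1(2)[OF x r] C2(2)[OF y r]])
      fix t assume "t \<in> space nu"
      have tri: "\<rho> \<le> dist x t + dist t y" by (simp add: \<rho>_def dist_triangle)
      have pw: "dist x t powr (-s) * dist t y powr (-u) \<le> (\<rho>/2) powr (-u) * dist x t powr (-s)"
        if "\<rho>/2 \<le> dist t y"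
        using powr_neg_antimono[OF _ that u(1)] \<rho> by (simp add: mult.commute[of "dist x t powr (-s)"] mult_right_mono)
      have pw': "dist x t powr (-s) * dist t y powr (-u) \<le> (\<rho>/2) powr (-s) * dist y t powr (-u)"
        if "\<rho>/2 \<le> dist x t"
        using powr_neg_antimono[OF _ that s(1)] \<rho> by (simp add: mult_right_mono dist_commute)
      show "ennreal (dist x t powr (-s) * dist t y powr (-u)) * indicator (ball x r) t
        \<le> ennreal ((\<rho>/2) powr (-u)) * (ennreal (dist x t powr (-s)) * indicator (ball x r) t)
          + ennreal ((\<rho>/2) powr (-s)) * (ennreal (dist y t powr (-u)) * indicator (ball y r) t)"
      proof (cases "t \<in> ball x r")
        case True
        show ?thesis
        proof (cases "\<rho>/2 \<le> dist t y")
          case ge: True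
          show ?thesis using pw[OF ge] True
            by (intro add_increasing2) (auto simp flip: ennreal_mult intro!: ennreal_leI)
        next
          case lt: False
          then have ge: "\<rho>/2 \<le> dist x t" using tri by simp
          \<comment> \<open>Here \<open>dist t y < \<rho>/2 \<le> dist x t < r\<close>, so a ball of
            the same radius about \<open>y\<close> suffices.\<close>
          have "t \<in> ball y r" using lt ge True by (simp add: dist_commute)
          then show ?thesis using pw'[OF ge] True
            by (intro add_increasing) (auto simp flip: ennreal_mult intro!: ennreal_leI)
        qed
      qed auto
    qed (use C1 C2 in auto)
    also have "\<dots> \<le> ennreal (C * (\<rho> powr (-u) * r powr (v - s) + \<rho> powr (-s) * r powr (v - u)))"
    proof (rule ennreal_leI)
      have half: "(\<rho>/2) powr (-w) = 2 powr w * \<rho> powr (-w)" for w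
        using \<rho> by (simp add: powr_divide powr_minus field_simps)
      show "(\<rho>/2) powr (-u) * (C1 * r powr (v - s)) + (\<rho>/2) powr (-s) * (C2 * r powr (v - u))
        \<le> C * (\<rho> powr (-u) * r powr (v - s) + \<rho> powr (-s) * r powr (v - u))"
        unfolding half C_def using C1 C2 by (simp add: algebra_simps)
    qed
    finally show "(\<integral>\<^sup>+t. ennreal (dist x t powr (-s) * dist t y powr (-u)) * indicator (ball x r) t \<partial>nu)
      \<le> ennreal (C * (dist x y powr (-u) * r powr (v - s) + dist x y powr (-s) * r powr (v - u)))"
      unfolding \<rho>_def .
  qed
qed

text \<open>The previous estimate with the roles of the two poles and of the two exponents
  exchanged.\<close>

lemma nn_integral_product_ball':
  assumes s: "0 \<le> s" "s < v" and u: "0 \<le> u" "u < v"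
  obtains C where "C > 0" and "\<And>x y r. x \<in> Y \<Longrightarrow> y \<in> Y \<Longrightarrow> x \<noteq> y \<Longrightarrow> 0 < r \<Longrightarrow>
    (\<integral>\<^sup>+t. ennreal (dist x t powr (-s) * dist t y powr (-u)) * indicator (ball y r) t \<partial>nu)
      \<le> ennreal (C * (dist x y powr (-u) * r powr (v - s) + dist x y powr (-s) * r powr (v - u)))"
proof -
  obtain C where C: "C > 0" "\<And>x y r. x \<in> Y \<Longrightarrow> y \<in> Y \<Longrightarrow> x \<noteq> y \<Longrightarrow> 0 < r \<Longrightarrow>
    (\<integral>\<^sup>+t. ennreal (dist x t powr (-u) * dist t y powr (-s)) * indicator (ball x r) t \<partial>nu)
      \<le> ennreal (C * (dist x y powr (-s) * r powr (v - u) + dist x y powr (-u) * r powr (v - s)))"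
    using nn_integral_product_ball[OF u s] by blast
  show thesis
  proof (rule that[OF C(1)])
    fix x y r assume "x \<in> Y" "y \<in> Y" "x \<noteq> y" "0 < (r::real)"
    then show "(\<integral>\<^sup>+t. ennreal (dist x t powr (-s) * dist t y powr (-u)) * indicator (ball y r) t \<partial>nu)
      \<le> ennreal (C * (dist x y powr (-u) * r powr (v - s) + dist x y powr (-s) * r powr (v - u)))"
      using C(2)[of y x r] by (simp add: dist_commute mult.commute add.commute)
  qed
qed

text \<open>The conditions on \<open>a\<close> cover the three cases at once: 0 below the critical
  sum, any positive number at it, \<open>s + u - v\<close> above it. The two half-radius balls each
  contribute order \<open>dist x y powr (v - s - u)\<close>, and \<open>v - s - u \<ge> -a\<close>;
  the rest goes to \<open>nn_integral_far\<close> with exponent \<open>s + u\<close>.\<close>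

lemma nn_integral_product:
  assumes s: "0 \<le> s" "s < v" and u: "0 \<le> u" "u < v"
    and a: "0 \<le> a" "s + u - v \<le> a" "s + u = v \<Longrightarrow> 0 < a"
  obtains C where "C > 0" and "\<And>x y. x \<in> Y \<Longrightarrow> y \<in> Y \<Longrightarrow> x \<noteq> y \<Longrightarrow>
    (\<integral>\<^sup>+t. ennreal (dist x t powr (-s) * dist t y powr (-u)) \<partial>nu)
      \<le> ennreal (C * dist x y powr (-a))"
proof -
  let ?w = "\<lambda>x y t. dist x t powr (-s) * dist t y powr (-u)"
  obtain C1 where C1: "C1 > 0" "\<And>x y r. x \<in> Y \<Longrightarrow> y \<in> Y \<Longrightarrow> x \<noteq> y \<Longrightarrow> 0 < r \<Longrightarrow>
    (\<integral>\<^sup>+t. ennreal (?w x y t) * indicator (ball x r) t \<partial>nu)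
      \<le> ennreal (C1 * (dist x y powr (-u) * r powr (v - s) + dist x y powr (-s) * r powr (v - u)))"
    using nn_integral_product_ball[OF s u] by blast
  obtain C2 where C2: "C2 > 0" "\<And>x y r. x \<in> Y \<Longrightarrow> y \<in> Y \<Longrightarrow> x \<noteq> y \<Longrightarrow> 0 < r \<Longrightarrow>
    (\<integral>\<^sup>+t. ennreal (?w x y t) * indicator (ball y r) t \<partial>nu)
      \<le> ennreal (C2 * (dist x y powr (-u) * r powr (v - s) + dist x y powr (-s) * r powr (v - u)))"
    using nn_integral_product_ball'[OF s u] by blast
  obtain C3 where C3: "C3 > 0" "\<And>x r. x \<in> Y \<Longrightarrow> 0 < r \<Longrightarrow> r \<le> D \<Longrightarrow>
    (\<integral>\<^sup>+t. ennreal (dist x t powr (-(s + u))) * indicator (- ball x r) t \<partial>nu)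
      \<le> ennreal (C3 * r powr (-a))"
    using nn_integral_far[OF add_nonneg_nonneg[OF s(1) u(1)] a] by blast
  \<comment> \<open>The first factor 2 counts the two equal terms of \<open>?G\<close>, the second
    the two poles of the far part; \<open>2 powr a\<close> comes from the radius
    \<open>\<rho>/2\<close>.\<close>
  define C where "C = (C1 + C2) * (2 * D powr (v - s - u + a)) + 2 * (C3 * 2 powr a)"
  show thesis
  proof (rule that[of C])
    show "C > 0" using C1 C2 C3 by (simp add: C_def add_nonneg_pos)
    fix x y assume x: "x \<in> Y" and y: "y \<in> Y" and xy: "x \<noteq> y"
    define \<rho> where "\<rho> = dist x y"
    have \<rho>: "\<rho> > 0" "\<rho> \<le> D" using xy dist_le[OF x y] by (simp_all add: \<rho>_def)
    let ?G = "\<rho> powr (-u) * (\<rho>/2) powr (v - s) + \<rho> powr (-s) * (\<rho>/2) powr (v - u)"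
    let ?N = "\<lambda>t. ennreal (?w x y t) * indicator (ball x (\<rho>/2)) t"
    let ?N' = "\<lambda>t. ennreal (?w x y t) * indicator (ball y (\<rho>/2)) t"
    let ?F = "\<lambda>z t. ennreal (dist z t powr (-(s + u))) * indicator (- ball z (\<rho>/2)) t"
    have near: "(\<integral>\<^sup>+t. ?N t + ?N' t \<partial>nu) \<le> ennreal (1 * (C1 * ?G) + 1 * (C2 * ?G))"
      using C1(2)[OF x y xy, of "\<rho>/2"] C2(2)[OF x y xy, of "\<rho>/2"] \<rho> C1 C2
      by (intro nn_integral_le_two[where g="?N" and h="?N'"]) (auto simp: \<rho>_def)
    have far: "(\<integral>\<^sup>+t. ?F x t + ?F y t \<partial>nu)
        \<le> ennreal (1 * (C3 * (\<rho>/2) powr (-a)) + 1 * (C3 * (\<rho>/2) powr (-a)))"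
      using C3(2)[OF x, of "\<rho>/2"] C3(2)[OF y, of "\<rho>/2"] \<rho> C3
      by (intro nn_integral_le_two[where g="?F x" and h="?F y"]) auto
    have "(\<integral>\<^sup>+t. ennreal (?w x y t) \<partial>nu)
      \<le> ennreal (1 * (1 * (C1 * ?G) + 1 * (C2 * ?G))
            + 1 * (1 * (C3 * (\<rho>/2) powr (-a)) + 1 * (C3 * (\<rho>/2) powr (-a))))"
    proof (rule nn_integral_le_two[OF _ _ _ near far])
      fix t assume "t \<in> space nu"
      show "ennreal (?w x y t) \<le> ennreal 1 * (?N t + ?N' t) + ennreal 1 * (?F x t + ?F y t)"
      proof (cases "t \<in> ball x (\<rho>/2) \<or> t \<in> ball y (\<rho>/2)")
        case True
        then have "ennreal (?w x y t) \<le> ?N t + ?N' t"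
          by (auto simp: add_increasing add_increasing2)
        then show ?thesis by (simp add: add_increasing2)
      next
        case False
        have "ennreal (?w x y t) \<le> ennreal (dist x t powr (-(s + u)) + dist t y powr (-(s + u)))"
          using s u by (intro ennreal_leI powr_neg_mult_le) auto
        then have "ennreal (?w x y t) \<le> ?F x t + ?F y t"
          using False by (auto simp: dist_commute)
        then show ?thesis by (simp add: add_increasing)
      qed
    qed (use C1 C2 C3 in auto)
    also have "\<dots> \<le> ennreal (C * \<rho> powr (-a))"
    proof (rule ennreal_leI)
      have half: "(\<rho>/2) powr (-a) = 2 powr a * \<rho> powr (-a)"
        using \<rho> by (simp add: powr_divide powr_minus field_simps)
      have "?G \<le> \<rho> powr (-u) * \<rho> powr (v - s) + \<rho> powr (-s) * \<rho> powr (v - u)"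
        using \<rho> s u by (intro add_mono mult_left_mono powr_mono2) auto
      also have "\<dots> = 2 * \<rho> powr (v - s - u)" by (simp add: algebra_simps flip: powr_add)
      also have "\<dots> \<le> 2 * (D powr (v - s - u + a) * \<rho> powr (-a))"
        using powr_le_of_bounded[OF \<rho>, of "-a" "v - s - u"] a by simp
      finally have "(C1 + C2) * ?G \<le> (C1 + C2) * (2 * (D powr (v - s - u + a) * \<rho> powr (-a)))"
        using C1 C2 by (intro mult_left_mono) auto
      then show "1 * (1 * (C1 * ?G) + 1 * (C2 * ?G))
            + 1 * (1 * (C3 * (\<rho>/2) powr (-a)) + 1 * (C3 * (\<rho>/2) powr (-a))) \<le> C * \<rho> powr (-a)"
        unfolding half C_def by (simp add: algebra_simps)
    qed
    finally show "(\<integral>\<^sup>+t. ennreal (?w x y t) \<partial>nu) \<le> ennreal (C * dist x y powr (-a))"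
      unfolding \<rho>_def .
  qed
qed

end

section \<open>The composite kernel: integrability and size\<close>

text \<open>Here \<open>s\<close> and \<open>u\<close> stand for the exponents \<open>s1\<close> and
  \<open>t1\<close>. Only size and continuity are shared; the Hoelder-type bound on
  \<open>K1\<close> is an assumption of the increment estimate alone.\<close>

locale composable_kernels = bounded_ahlfors Y nu v c D
  for Y :: "'a::metric_space set" and nu :: "'a measure" and v c D :: real +
  fixes K1 K2 :: "'a \<Rightarrow> 'a \<Rightarrow> complex" and s u M1 M2 :: real
  assumes s: "0 \<le> s" "s < v" and u: "0 \<le> u" "u < v"
    and cont1: "offdiag_continuous Y K1" and cont2: "offdiag_continuous Y K2"
    and M1: "0 \<le> M1" and M2: "0 \<le> M2"
    and bound1: "\<And>x t. x \<in> Y \<Longrightarrow> t \<in> Y \<Longrightarrow> x \<noteq> t \<Longrightarrow> norm (K1 x t) \<le> M1 * dist x t powr (-s)"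
    and bound2: "\<And>t y. t \<in> Y \<Longrightarrow> y \<in> Y \<Longrightarrow> t \<noteq> y \<Longrightarrow> norm (K2 t y) \<le> M2 * dist t y powr (-u)"
begin

abbreviation w :: "'a \<Rightarrow> 'a \<Rightarrow> 'a \<Rightarrow> real" where
  "w x y t \<equiv> dist x t powr (-s) * dist t y powr (-u)"

lemma product_measurable:
  assumes "x \<in> Y" "y \<in> Y"
  shows "(\<lambda>t. K1 x t * K2 t y) \<in> borel_measurable nu"
proof (rule measurable_continuous_off_finite[where S = "{x, y}"])
  have "continuous_on (Y - {x, y}) (\<lambda>t. case (x, t) of (x, y) \<Rightarrow> K1 x y)"
    by (rule continuous_on_compose2[OF cont1[unfolded offdiag_continuous_def]])
      (use assms in \<open>auto intro!: continuous_intros\<close>)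
  moreover have "continuous_on (Y - {x, y}) (\<lambda>t. case (t, y) of (x, y) \<Rightarrow> K2 x y)"
    by (rule continuous_on_compose2[OF cont2[unfolded offdiag_continuous_def]])
      (use assms in \<open>auto intro!: continuous_intros\<close>)
  ultimately show "continuous_on (Y - {x, y}) (\<lambda>t. K1 x t * K2 t y)"
    by (auto intro!: continuous_on_mult)
qed simp

lemma norm_product_le:
  assumes "x \<in> Y" "y \<in> Y" "t \<in> Y" "t \<noteq> x" "t \<noteq> y"
  shows "norm (K1 x t * K2 t y) \<le> M1 * M2 * w x y t"
proof -
  have "norm (K1 x t * K2 t y) \<le> (M1 * dist x t powr (-s)) * (M2 * dist t y powr (-u))"
    unfolding norm_mult using assms M1 M2
    by (intro mult_mono bound1 bound2) auto
  then show ?thesis by (simp add: mult_ac)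
qed

text \<open>The pointwise bound can fail only at the two poles, which are null. The weight
  \<open>g\<close> is 1 for global estimates and an indicator for local ones.\<close>

lemma nn_integral_kernel_le:
  assumes x: "x \<in> Y" and y: "y \<in> Y" and [measurable]: "g \<in> borel_measurable nu"
  shows "(\<integral>\<^sup>+t. ennreal (norm (K1 x t * K2 t y)) * g t \<partial>nu)
    \<le> ennreal (M1 * M2) * (\<integral>\<^sup>+t. ennreal (w x y t) * g t \<partial>nu)"
proof -
  have "(\<integral>\<^sup>+t. ennreal (norm (K1 x t * K2 t y)) * g t \<partial>nu)
    \<le> (\<integral>\<^sup>+t. ennreal (M1 * M2) * (ennreal (w x y t) * g t) \<partial>nu)"
  proof (rule nn_integral_mono_AE)
    show "AE t in nu. ennreal (norm (K1 x t * K2 t y)) * g t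
        \<le> ennreal (M1 * M2) * (ennreal (w x y t) * g t)"
      using AE_neq[OF x] AE_neq[OF y] AE_space
    proof eventually_elim
      case (elim t)
      then have "ennreal (norm (K1 x t * K2 t y)) \<le> ennreal (M1 * M2 * w x y t)"
        using norm_product_le[OF x y] by (intro ennreal_leI) (auto simp: space_nu)
      then show ?case
        using M1 M2 by (simp add: ennreal_mult mult.assoc[symmetric] mult_right_mono)
    qed
  qed
  also have "\<dots> = ennreal (M1 * M2) * (\<integral>\<^sup>+t. ennreal (w x y t) * g t \<partial>nu)"
    by (rule nn_integral_cmult) measurable
  finally show ?thesis .
qed

lemma nn_integral_norm_product:
  assumes a: "0 \<le> a" "s + u - v \<le> a" "s + u = v \<Longrightarrow> 0 < a"
  obtains C where "0 < C" and "\<And>x y. x \<in> Y \<Longrightarrow> y \<in> Y \<Longrightarrow> x \<noteq> y \<Longrightarrow>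
    (\<integral>\<^sup>+t. ennreal (norm (K1 x t * K2 t y)) \<partial>nu) \<le> ennreal (M1 * M2 * C * dist x y powr (-a))"
proof -
  obtain C where C: "C > 0" "\<And>x y. x \<in> Y \<Longrightarrow> y \<in> Y \<Longrightarrow> x \<noteq> y \<Longrightarrow>
    (\<integral>\<^sup>+t. ennreal (w x y t) \<partial>nu) \<le> ennreal (C * dist x y powr (-a))"
    using nn_integral_product[OF s u a] by blast
  show thesis
  proof (rule that[OF C(1)])
    fix x y assume xy: "x \<in> Y" "y \<in> Y" "x \<noteq> y"
    have "(\<integral>\<^sup>+t. ennreal (norm (K1 x t * K2 t y)) \<partial>nu)
        \<le> ennreal (M1 * M2) * (\<integral>\<^sup>+t. ennreal (w x y t) \<partial>nu)"
      using nn_integral_kernel_le[of x y "\<lambda>_. 1"] xy by simp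
    also have "\<dots> \<le> ennreal (M1 * M2) * ennreal (C * dist x y powr (-a))"
      by (intro mult_left_mono C xy) simp
    also have "\<dots> = ennreal (M1 * M2 * C * dist x y powr (-a))"
      using C M1 M2 by (simp add: mult.assoc flip: ennreal_mult)
    finally show "(\<integral>\<^sup>+t. ennreal (norm (K1 x t * K2 t y)) \<partial>nu)
      \<le> ennreal (M1 * M2 * C * dist x y powr (-a))" .
  qed
qed

lemma integrable_product:
  assumes "x \<in> Y" "y \<in> Y" "x \<noteq> y"
  shows "integrable nu (\<lambda>t. K1 x t * K2 t y)"
proof -
  \<comment> \<open>Only finiteness matters here, so the crude exponent \<open>s + u\<close> is
    taken; it is admissible in every case because \<open>v > 0\<close>.\<close>
  have a: "0 \<le> s + u" "s + u - v \<le> s + u" "s + u = v \<Longrightarrow> 0 < s + u"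
    using s u v_pos by auto
  obtain C where "0 < C" and C: "\<And>x y. x \<in> Y \<Longrightarrow> y \<in> Y \<Longrightarrow> x \<noteq> y \<Longrightarrow>
    (\<integral>\<^sup>+t. ennreal (norm (K1 x t * K2 t y)) \<partial>nu)
      \<le> ennreal (M1 * M2 * C * dist x y powr (- (s + u)))"
    using nn_integral_norm_product[OF a] by blast
  from C[OF assms] show ?thesis
    using product_measurable assms(1,2)
    by (auto simp: integrable_iff_bounded less_top[symmetric] top_unique)
qed

lemma norm_integral_product_le:
  assumes a: "0 \<le> a" "s + u - v \<le> a" "s + u = v \<Longrightarrow> 0 < a"
  shows "\<exists>C. \<forall>x\<in>Y. \<forall>y\<in>Y. x \<noteq> y \<longrightarrow>
    dist x y powr a * norm (\<integral>t. K1 x t * K2 t y \<partial>nu) \<le> C"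
proof -
  obtain C where C: "0 < C" "\<And>x y. x \<in> Y \<Longrightarrow> y \<in> Y \<Longrightarrow> x \<noteq> y \<Longrightarrow>
    (\<integral>\<^sup>+t. ennreal (norm (K1 x t * K2 t y)) \<partial>nu) \<le> ennreal (M1 * M2 * C * dist x y powr (-a))"
    using nn_integral_norm_product[OF a] by blast
  show ?thesis
  proof (intro exI ballI impI)
    fix x y assume xy: "x \<in> Y" "y \<in> Y" "x \<noteq> y"
    have "ennreal (norm (\<integral>t. K1 x t * K2 t y \<partial>nu)) \<le> ennreal (M1 * M2 * C * dist x y powr (-a))"
      using integral_norm_bound_ennreal[OF integrable_product[OF xy]] C(2)[OF xy]
      by (rule order_trans)
    then have "norm (\<integral>t. K1 x t * K2 t y \<partial>nu) \<le> M1 * M2 * C * dist x y powr (-a)"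
      using C M1 M2 by simp
    then show "dist x y powr a * norm (\<integral>t. K1 x t * K2 t y \<partial>nu) \<le> M1 * M2 * C"
      using xy(3) by (simp add: powr_minus field_simps)
  qed
qed

section \<open>Increments of the composite kernel in its first variable\<close>

text \<open>The near ball produces the powers \<open>v - s\<close> and \<open>v - u\<close> of
  \<open>dist x' x''\<close>, the far region produces \<open>s3 - q\<close>; \<open>m\<close> lies
  below all three. In the same way \<open>a\<close> dominates \<open>s\<close> and \<open>u\<close>,
  the exponents of the factor frozen in the near ball, and \<open>p + u - v\<close>, the exponent of
  the far integral.\<close>

lemma norm_integral_product_diff_le:
  assumes holder: "\<And>x' x'' t. x' \<in> Y \<Longrightarrow> x'' \<in> Y \<Longrightarrow> t \<in> Y \<Longrightarrow> x' \<noteq> x'' \<Longrightarrow>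
        t \<notin> ball x' (2 * dist x' x'') \<Longrightarrow>
        norm (K1 x' t - K1 x'' t) \<le> H * dist x' x'' powr s3 * dist x' t powr (-(p + q))"
    and H: "0 \<le> H" and p: "0 \<le> p" "p < v" and q: "0 \<le> q" "q \<le> s3"
    and a: "s \<le> a" "u \<le> a" "p + u - v \<le> a" "p + u = v \<Longrightarrow> 0 < a"
    and m: "m \<le> s3 - q" "m \<le> v - s" "m \<le> v - u"
  shows "\<exists>C. \<forall>x'\<in>Y. \<forall>x''\<in>Y. \<forall>y\<in>Y. x' \<noteq> x'' \<and> y \<notin> ball x' (2 * dist x' x'') \<longrightarrow>
     dist x' y powr a / dist x' x'' powr m *
       norm ((\<integral>t. K1 x' t * K2 t y \<partial>nu) - (\<integral>t. K1 x'' t * K2 t y \<partial>nu)) \<le> C"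
proof -
  obtain C1 where C1: "C1 > 0" "\<And>x y r. x \<in> Y \<Longrightarrow> y \<in> Y \<Longrightarrow> x \<noteq> y \<Longrightarrow> 0 < r \<Longrightarrow>
    (\<integral>\<^sup>+t. ennreal (w x y t) * indicator (ball x r) t \<partial>nu)
      \<le> ennreal (C1 * (dist x y powr (-u) * r powr (v - s) + dist x y powr (-s) * r powr (v - u)))"
    using nn_integral_product_ball[OF s u] by blast
  have a0: "0 \<le> a" using a s by simp
  obtain C2 where C2: "C2 > 0" "\<And>x y. x \<in> Y \<Longrightarrow> y \<in> Y \<Longrightarrow> x \<noteq> y \<Longrightarrow>
    (\<integral>\<^sup>+t. ennreal (dist x t powr (-p) * dist t y powr (-u)) \<partial>nu) \<le> ennreal (C2 * dist x y powr (-a))"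
    using nn_integral_product[OF p u a0 a(3,4)] by blast
  \<comment> \<open>\<open>E\<close> serves every exponent between \<open>m\<close> and
    \<open>v + s3\<close>, hence \<open>v - s\<close>, \<open>v - u\<close> and
    \<open>s3 - q\<close> together. \<open>F\<close> collects the constants from freezing a factor
    and from the radius \<open>3 * \<delta>\<close>.\<close>
  define E where "E = D powr (v + s3 - m)"
  define F where "F = 2 powr v * D powr a * (3 powr v * E)"
  have EF: "E > 0" "F > 0" using D_ge by (simp_all add: E_def F_def)
  \<comment> \<open>The 4 counts two centres, \<open>x'\<close> and \<open>x''\<close>, with two
    terms each.\<close>
  define C where "C = M1 * M2 * (4 * C1 * F) + H * M2 * E * C2"
  have main: "norm ((\<integral>t. K1 x' t * K2 t y \<partial>nu) - (\<integral>t. K1 x'' t * K2 t y \<partial>nu))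
      \<le> C * (dist x' y powr (-a) * dist x' x'' powr m)"
    if Y: "x' \<in> Y" "x'' \<in> Y" "y \<in> Y" and neq: "x' \<noteq> x''" and ny: "y \<notin> ball x' (2 * dist x' x'')"
    for x' x'' y
  proof -
    define \<delta> R where "\<delta> = dist x' x''" and "R = dist x' y"
    have \<delta>: "0 < \<delta>" "\<delta> \<le> D" using neq dist_le Y by (auto simp: \<delta>_def)
    have R: "2 * \<delta> \<le> R" "0 < R" "R \<le> D" using ny \<delta> dist_le Y by (auto simp: \<delta>_def R_def)
    \<comment> \<open>As \<open>\<delta> \<le> R / 2\<close>, the point \<open>x''\<close> is still
      comparably far from \<open>y\<close>, and one estimate \<open>near\<close> serves both
      centres.\<close>
    have R'': "R / 2 \<le> dist x'' y"
      using R dist_triangle[of x' y x''] by (simp add: \<delta>_def R_def)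
    have xy: "x' \<noteq> y" "x'' \<noteq> y" using R R'' by (auto simp: R_def)
    have \<delta>_le: "\<delta> powr e \<le> E * \<delta> powr m" if "m \<le> e" "e \<le> v + s3" for e
    proof -
      have "\<delta> powr e \<le> D powr (e - m) * \<delta> powr m" using powr_le_of_bounded[OF \<delta> that(1)] .
      also have "\<dots> \<le> E * \<delta> powr m"
        unfolding E_def using that D_ge by (intro mult_right_mono powr_mono) auto
      finally show ?thesis .
    qed
    have R_le: "z powr (-e) \<le> 2 powr v * D powr a * R powr (-a)"
      if "R / 2 \<le> z" "0 \<le> e" "e \<le> a" "e \<le> v" for e z
    proof -
      have "z powr (-e) \<le> (R/2) powr (-e)" using that R by (intro powr_neg_antimono) auto
      also have "\<dots> = 2 powr e * R powr (-e)"
        using R by (simp add: powr_divide powr_minus field_simps)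
      also have "\<dots> \<le> 2 powr v * (D powr a * R powr (-a))"
      proof (rule mult_mono)
        have "R powr (-e) \<le> D powr (a - e) * R powr (-a)"
          using powr_le_of_bounded[OF R(2,3), of "-a" "-e"] that by simp
        also have "\<dots> \<le> D powr a * R powr (-a)"
          using that D_ge by (intro mult_right_mono powr_mono) auto
        finally show "R powr (-e) \<le> D powr a * R powr (-a)" .
      qed (use that in auto)
      finally show ?thesis by (simp add: mult.assoc)
    qed
    have three: "(3 * \<delta>) powr e \<le> 3 powr v * E * \<delta> powr m" if "m \<le> e" "0 \<le> e" "e \<le> v" for e
    proof -
      have "(3 * \<delta>) powr e = 3 powr e * \<delta> powr e" using \<delta> by (simp add: powr_mult)
      also have "\<dots> \<le> 3 powr v * (E * \<delta> powr m)"
        using that q by (intro mult_mono \<delta>_le) auto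
      finally show ?thesis by (simp add: mult.assoc)
    qed
    let ?T = "R powr (-a) * \<delta> powr m"
    have near: "(\<integral>\<^sup>+t. ennreal (w z y t) * indicator (ball z (3 * \<delta>)) t \<partial>nu) \<le> ennreal (2 * C1 * F * ?T)"
      if z: "z \<in> Y" "z \<noteq> y" "R / 2 \<le> dist z y" for z
    proof -
      have t1: "dist z y powr (-u) * (3 * \<delta>) powr (v - s)
          \<le> (2 powr v * D powr a * R powr (-a)) * (3 powr v * E * \<delta> powr m)"
        using z s u a m by (intro mult_mono R_le three) auto
      have t2: "dist z y powr (-s) * (3 * \<delta>) powr (v - u)
          \<le> (2 powr v * D powr a * R powr (-a)) * (3 powr v * E * \<delta> powr m)"
        using z s u a m by (intro mult_mono R_le three) auto
      have "C1 * (dist z y powr (-u) * (3 * \<delta>) powr (v - s) + dist z y powr (-s) * (3 * \<delta>) powr (v - u))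
          \<le> C1 * (F * ?T + F * ?T)"
        using t1 t2 C1(1) unfolding F_def by (intro mult_left_mono add_mono) (auto simp: mult_ac)
      then have le: "ennreal (C1 * (dist z y powr (-u) * (3 * \<delta>) powr (v - s)
            + dist z y powr (-s) * (3 * \<delta>) powr (v - u)))
          \<le> ennreal (2 * C1 * F * ?T)"
        by (intro ennreal_leI) (simp add: algebra_simps)
      show ?thesis
        using order_trans[OF C1(2)[OF z(1) Y(3) z(2), of "3 * \<delta>"] le] \<delta> by simp
    qed
    let ?N = "\<lambda>z t. ennreal (w z y t) * indicator (ball z (3 * \<delta>)) t"
    let ?W = "\<lambda>t. ennreal (dist x' t powr (-p) * dist t y powr (-u))"
    let ?f = "\<lambda>t. K1 x' t * K2 t y - K1 x'' t * K2 t y"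
    have ints: "integrable nu (\<lambda>t. K1 x' t * K2 t y)" "integrable nu (\<lambda>t. K1 x'' t * K2 t y)"
      using integrable_product Y xy by auto
    have N: "(\<integral>\<^sup>+t. ?N x' t + ?N x'' t \<partial>nu)
        \<le> ennreal (1 * (2 * C1 * F * ?T) + 1 * (2 * C1 * F * ?T))"
      using near[OF Y(1) xy(1)] near[OF Y(2) xy(2) R''] R C1(1) EF
      by (intro nn_integral_le_two[where g="?N x'" and h="?N x''"]) (auto simp: R_def)
    have "ennreal (norm (\<integral>t. ?f t \<partial>nu)) \<le> (\<integral>\<^sup>+t. ennreal (norm (?f t)) \<partial>nu)"
      using ints by (intro integral_norm_bound_ennreal) auto
    also have "\<dots> \<le> (\<integral>\<^sup>+t. ennreal (M1 * M2) * (?N x' t + ?N x'' t)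
        + ennreal (H * M2 * \<delta> powr (s3 - q)) * ?W t \<partial>nu)"
    proof (rule nn_integral_mono_AE)
      show "AE t in nu. ennreal (norm (?f t)) \<le> ennreal (M1 * M2) * (?N x' t + ?N x'' t)
        + ennreal (H * M2 * \<delta> powr (s3 - q)) * ?W t"
        using AE_neq[OF Y(1)] AE_neq[OF Y(2)] AE_neq[OF Y(3)] AE_space
      proof eventually_elim
        case (elim t)
        then have tY: "t \<in> Y" by (simp add: space_nu)
        show ?case
        proof (cases "t \<in> ball x' (2 * \<delta>)")
          case True
          \<comment> \<open>The radius 3 is 2 plus 1: passing from \<open>x'\<close> to
            \<open>x''\<close> adds \<open>\<delta>\<close>.\<close>
          then have "t \<in> ball x' (3 * \<delta>)" "t \<in> ball x'' (3 * \<delta>)"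
            using \<delta> dist_triangle[of x'' t x'] dist_commute[of x' x''] unfolding \<delta>_def mem_ball
            by linarith+
          moreover have "norm (?f t) \<le> M1 * M2 * w x' y t + M1 * M2 * w x'' y t"
            using norm_product_le[of x' y t] norm_product_le[of x'' y t] elim tY Y
            by (intro order_trans[OF norm_triangle_ineq4 add_mono]) auto
          ultimately have "ennreal (norm (?f t)) \<le> ennreal (M1 * M2) * (?N x' t + ?N x'' t)"
            using M1 M2
            by (auto simp: distrib_left[symmetric] simp flip: ennreal_mult ennreal_plus intro!: ennreal_leI)
          then show ?thesis by (simp add: add_increasing2)
        next
          case False
          then have far: "2 * \<delta> \<le> dist x' t" by simp
          have "norm (?f t) = norm (K1 x' t - K1 x'' t) * norm (K2 t y)"
            by (simp add: norm_mult[symmetric] algebra_simps)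
          also have "\<dots> \<le> (H * \<delta> powr s3 * dist x' t powr (-(p + q))) * (M2 * dist t y powr (-u))"
            using holder[OF Y(1,2) tY neq] False bound2[OF tY Y(3)] elim H
            by (intro mult_mono) (auto simp: \<delta>_def)
          also have "dist x' t powr (-(p + q)) = dist x' t powr (-p) * dist x' t powr (-q)"
            by (simp flip: powr_add)
          \<comment> \<open>Outside the ball \<open>dist x' t \<ge> \<delta>\<close>, so the part
            \<open>q\<close> of the exponent becomes a power of \<open>\<delta>\<close>. What
            remains has exponent \<open>p < v\<close> at \<open>x'\<close> and is integrable over
            all of \<open>Y\<close>.\<close>
          also have "(H * \<delta> powr s3 * (dist x' t powr (-p) * dist x' t powr (-q))) * (M2 * dist t y powr (-u))
              \<le> (H * \<delta> powr s3 * (dist x' t powr (-p) * \<delta> powr (-q))) * (M2 * dist t y powr (-u))"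
            using far \<delta> q H M2 by (intro mult_right_mono mult_left_mono powr_neg_antimono) auto
          also have "\<dots> = H * M2 * \<delta> powr (s3 - q) * (dist x' t powr (-p) * dist t y powr (-u))"
            by (simp add: powr_diff powr_minus field_simps)
          finally have "ennreal (norm (?f t)) \<le> ennreal (H * M2 * \<delta> powr (s3 - q)) * ?W t"
            using H M2 by (simp flip: ennreal_mult add: ennreal_leI)
          then show ?thesis by (simp add: add_increasing)
        qed
      qed
    qed
    also have "\<dots> \<le> ennreal (M1 * M2 * (1 * (2 * C1 * F * ?T) + 1 * (2 * C1 * F * ?T))
        + H * M2 * \<delta> powr (s3 - q) * (C2 * R powr (-a)))"
      using C2(2)[OF Y(1,3) xy(1)] M1 M2 H C1(1) C2(1) EF
      by (intro nn_integral_le_two[OF order_refl _ _ N]) (auto simp: R_def)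
    also have "\<dots> \<le> ennreal (C * ?T)"
    proof (rule ennreal_leI)
      have "H * M2 * \<delta> powr (s3 - q) * (C2 * R powr (-a)) \<le> H * M2 * (E * \<delta> powr m) * (C2 * R powr (-a))"
        using H M2 C2(1) m q v_pos by (intro mult_right_mono mult_left_mono \<delta>_le) auto
      then show "M1 * M2 * (1 * (2 * C1 * F * ?T) + 1 * (2 * C1 * F * ?T))
        + H * M2 * \<delta> powr (s3 - q) * (C2 * R powr (-a)) \<le> C * ?T"
        by (simp add: C_def algebra_simps)
    qed
    finally have "norm (\<integral>t. ?f t \<partial>nu) \<le> C * ?T"
      using M1 M2 H C1(1) C2(1) EF by (simp add: C_def)
    then show ?thesis using ints by (simp add: R_def \<delta>_def)
  qed
  show ?thesis
  proof (intro exI ballI impI)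
    fix x' x'' y assume Y: "x' \<in> Y" "x'' \<in> Y" "y \<in> Y"
      and "x' \<noteq> x'' \<and> y \<notin> ball x' (2 * dist x' x'')"
    then have A: "x' \<noteq> x''" "y \<notin> ball x' (2 * dist x' x'')" by auto
    have "0 < dist x' x''" using A by simp
    with A(2) have "0 < dist x' y" by (auto simp del: zero_less_dist_iff)
    with \<open>0 < dist x' x''\<close> main[OF Y A]
    show "dist x' y powr a / dist x' x'' powr m *
       norm ((\<integral>t. K1 x' t * K2 t y \<partial>nu) - (\<integral>t. K1 x'' t * K2 t y \<partial>nu)) \<le> C"
      by (simp add: powr_minus field_simps)
  qed
qed

section \<open>Continuity of the composite kernel off the diagonal\<close>

text \<open>The bound \<open>\<eta>\<close> depends on the poles only through the lower bound
  \<open>\<delta>\<close> on their separation, so it is uniform along moving poles. It tends to 0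
  because \<open>v - s\<close> and \<open>v - u\<close> are positive.\<close>

lemma nn_integral_norm_product_near_small:
  assumes "0 < \<delta>"
  obtains \<eta> where "(\<eta> \<longlongrightarrow> 0) (at_right 0)" and "\<And>r. 0 \<le> \<eta> r"
    and "\<And>x y r. x \<in> Y \<Longrightarrow> y \<in> Y \<Longrightarrow> \<delta> \<le> dist x y \<Longrightarrow> 0 < r \<Longrightarrow>
      (\<integral>\<^sup>+t. ennreal (norm (K1 x t * K2 t y)) * indicator (ball x r \<union> ball y r) t \<partial>nu)
        \<le> ennreal (\<eta> r)"
proof -
  obtain C1 where C1: "C1 > 0" "\<And>x y r. x \<in> Y \<Longrightarrow> y \<in> Y \<Longrightarrow> x \<noteq> y \<Longrightarrow> 0 < r \<Longrightarrow>
    (\<integral>\<^sup>+t. ennreal (w x y t) * indicator (ball x r) t \<partial>nu)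
      \<le> ennreal (C1 * (dist x y powr (-u) * r powr (v - s) + dist x y powr (-s) * r powr (v - u)))"
    using nn_integral_product_ball[OF s u] by blast
  obtain C2 where C2: "C2 > 0" "\<And>x y r. x \<in> Y \<Longrightarrow> y \<in> Y \<Longrightarrow> x \<noteq> y \<Longrightarrow> 0 < r \<Longrightarrow>
    (\<integral>\<^sup>+t. ennreal (w x y t) * indicator (ball y r) t \<partial>nu)
      \<le> ennreal (C2 * (dist x y powr (-u) * r powr (v - s) + dist x y powr (-s) * r powr (v - u)))"
    using nn_integral_product_ball'[OF s u] by blast
  define G where "G r = \<delta> powr (-u) * r powr (v - s) + \<delta> powr (-s) * r powr (v - u)" for r :: real
  have G: "0 \<le> G r" for r by (simp add: G_def)
  define \<eta> where "\<eta> r = M1 * M2 * (1 * (C1 * G r) + 1 * (C2 * G r))" for r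
  show thesis
  proof (rule that[of \<eta>])
    have pw: "((\<lambda>r::real. r powr e) \<longlongrightarrow> 0) (at_right 0)" if "0 < e" for e :: real
      using that by (intro tendsto_zero_powrI[OF _ tendsto_const])
        (auto simp: eventually_at_filter)
    have "(\<eta> \<longlongrightarrow> M1 * M2 * (1 * (C1 * (\<delta> powr (-u) * 0 + \<delta> powr (-s) * 0))
        + 1 * (C2 * (\<delta> powr (-u) * 0 + \<delta> powr (-s) * 0)))) (at_right 0)"
      unfolding \<eta>_def G_def using s u by (intro tendsto_intros pw) auto
    then show "(\<eta> \<longlongrightarrow> 0) (at_right 0)" by simp
    show "0 \<le> \<eta> r" for r using M1 M2 C1(1) C2(1) G by (simp add: \<eta>_def)
    fix x y r assume xy: "x \<in> Y" "y \<in> Y" and d: "\<delta> \<le> dist x y" and r: "0 < (r::real)"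
    have neq: "x \<noteq> y" using d assms by auto
    have GG: "dist x y powr (-u) * r powr (v - s) + dist x y powr (-s) * r powr (v - u) \<le> G r"
      unfolding G_def using d assms s u
      by (intro add_mono mult_right_mono powr_neg_antimono) auto
    have "ennreal (C1 * (dist x y powr (-u) * r powr (v - s) + dist x y powr (-s) * r powr (v - u)))
        \<le> ennreal (C1 * G r)"
      using GG C1(1) by (intro ennreal_leI mult_left_mono) auto
    note N1 = order_trans[OF C1(2)[OF xy neq r] this]
    have "ennreal (C2 * (dist x y powr (-u) * r powr (v - s) + dist x y powr (-s) * r powr (v - u)))
        \<le> ennreal (C2 * G r)"
      using GG C2(1) by (intro ennreal_leI mult_left_mono) auto
    note N2 = order_trans[OF C2(2)[OF xy neq r] this]
    have "(\<integral>\<^sup>+t. ennreal (norm (K1 x t * K2 t y)) * indicator (ball x r \<union> ball y r) t \<partial>nu)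
        \<le> ennreal (M1 * M2) * (\<integral>\<^sup>+t. ennreal (w x y t) * indicator (ball x r \<union> ball y r) t \<partial>nu)"
      using xy by (intro nn_integral_kernel_le) auto
    also have "(\<integral>\<^sup>+t. ennreal (w x y t) * indicator (ball x r \<union> ball y r) t \<partial>nu)
        \<le> ennreal (1 * (C1 * G r) + 1 * (C2 * G r))"
      using C1(1) C2(1) G
      by (intro nn_integral_le_two[OF _ _ _ N1 N2]) (auto simp: indicator_def)
    finally show "(\<integral>\<^sup>+t. ennreal (norm (K1 x t * K2 t y)) * indicator (ball x r \<union> ball y r) t \<partial>nu)
        \<le> ennreal (\<eta> r)"
      using M1 M2 C1(1) C2(1) G by (simp add: \<eta>_def ennreal_mult mult_left_mono)
  qed
qed

lemma tendsto_product:
  assumes "x0 \<in> Y" "y0 \<in> Y" "t \<in> Y" "t \<noteq> x0" "t \<noteq> y0"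
    and XZ: "\<And>n. X n \<in> Y" "\<And>n. Z n \<in> Y" and lim: "X \<longlonglongrightarrow> x0" "Z \<longlonglongrightarrow> y0"
  shows "(\<lambda>n. K1 (X n) t * K2 t (Z n)) \<longlonglongrightarrow> K1 x0 t * K2 t y0"
proof (rule tendsto_mult)
  let ?O = "{(x, y). x \<in> Y \<and> y \<in> Y \<and> x \<noteq> y}"
  have "\<forall>\<^sub>F n in sequentially. X n \<noteq> t" "\<forall>\<^sub>F n in sequentially. Z n \<noteq> t"
    using tendsto_imp_eventually_ne[OF lim(1)] tendsto_imp_eventually_ne[OF lim(2)] assms by auto
  then have ev: "\<forall>\<^sub>F n in sequentially. (X n, t) \<in> ?O" "\<forall>\<^sub>F n in sequentially. (t, Z n) \<in> ?O"
    using assms(3) XZ by (force elim: eventually_mono)+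
  have "(\<lambda>n. case (X n, t) of (x, y) \<Rightarrow> K1 x y) \<longlonglongrightarrow> (case (x0, t) of (x, y) \<Rightarrow> K1 x y)"
    by (rule continuous_on_tendsto_compose[OF cont1[unfolded offdiag_continuous_def] _ _ ev(1)])
      (use assms in \<open>auto intro!: tendsto_intros\<close>)
  then show "(\<lambda>n. K1 (X n) t) \<longlonglongrightarrow> K1 x0 t" by simp
  have "(\<lambda>n. case (t, Z n) of (x, y) \<Rightarrow> K2 x y) \<longlonglongrightarrow> (case (t, y0) of (x, y) \<Rightarrow> K2 x y)"
    by (rule continuous_on_tendsto_compose[OF cont2[unfolded offdiag_continuous_def] _ _ ev(2)])
      (use assms in \<open>auto intro!: tendsto_intros\<close>)
  then show "(\<lambda>n. K2 t (Z n)) \<longlonglongrightarrow> K2 t y0" by simp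
qed

text \<open>\<open>Y\<close> is cut into sets \<open>P\<close> and \<open>Q\<close> that stay fixed
  while the poles move. On \<open>P\<close>, close to the limit poles, all integrals are uniformly
  small; on \<open>Q\<close> the moving poles stay away and dominated convergence applies.\<close>

lemma tendsto_integral_product:
  assumes x0: "x0 \<in> Y" and y0: "y0 \<in> Y" and neq0: "x0 \<noteq> y0"
    and XZ: "\<And>n. X n \<in> Y" "\<And>n. Z n \<in> Y" "\<And>n. X n \<noteq> Z n"
    and lim: "X \<longlonglongrightarrow> x0" "Z \<longlonglongrightarrow> y0"
  shows "(\<lambda>n. \<integral>t. K1 (X n) t * K2 t (Z n) \<partial>nu) \<longlonglongrightarrow> (\<integral>t. K1 x0 t * K2 t y0 \<partial>nu)"
proof (rule metric_LIMSEQ_I)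
  fix e :: real assume e: "0 < e"
  let ?f = "\<lambda>x y t. K1 x t * K2 t y"
  \<comment> \<open>Half of the limiting separation, so the moving poles are eventually more than
    \<open>\<delta>\<close> apart.\<close>
  define \<delta> where "\<delta> = dist x0 y0 / 2"
  have \<delta>: "0 < \<delta>" using neq0 by (simp add: \<delta>_def)
  obtain \<eta> where \<eta>: "(\<eta> \<longlongrightarrow> 0) (at_right 0)" "\<And>r. 0 \<le> \<eta> r"
    and small: "\<And>x y r. x \<in> Y \<Longrightarrow> y \<in> Y \<Longrightarrow> \<delta> \<le> dist x y \<Longrightarrow> 0 < r \<Longrightarrow>
      (\<integral>\<^sup>+t. ennreal (norm (?f x y t)) * indicator (ball x r \<union> ball y r) t \<partial>nu) \<le> ennreal (\<eta> r)"
    using nn_integral_norm_product_near_small[OF \<delta>] by blast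
  have "\<forall>\<^sub>F r in at_right 0. \<eta> r < e / 4" using \<eta>(1) e by (intro order_tendstoD(2)) auto
  then obtain r' where "0 < r'" "\<eta> r' < e / 4"
    unfolding eventually_at_right_field by (metis dense)
  \<comment> \<open>Smallness is asked at \<open>2 * r\<close>, because balls of that radius about
    the moving poles cover the fixed set \<open>P\<close> once these poles are within
    \<open>r / 2\<close> of their limits.\<close>
  then obtain r where r: "0 < r" "\<eta> (2 * r) < e / 4"
    by (metis half_gt_zero field_sum_of_halves mult_2)
  define P where "P = (ball x0 r \<union> ball y0 r) \<inter> Y"
  define Q where "Q = (- (ball x0 r \<union> ball y0 r)) \<inter> Y"
  have PQ: "P \<in> sets nu" "Q \<in> sets nu" unfolding P_def Q_def by (intro sets_nu; simp)+
  have split: "(\<integral>t. ?f x y t \<partial>nu)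
      = (\<integral>t. indicator P t *\<^sub>R ?f x y t \<partial>nu) + (\<integral>t. indicator Q t *\<^sub>R ?f x y t \<partial>nu)"
    if "x \<in> Y" "y \<in> Y" "x \<noteq> y" for x y
  proof -
    have "(\<integral>t. ?f x y t \<partial>nu) = (\<integral>t. indicator P t *\<^sub>R ?f x y t + indicator Q t *\<^sub>R ?f x y t \<partial>nu)"
      by (intro Bochner_Integration.integral_cong) (auto simp: P_def Q_def space_nu indicator_def)
    then show ?thesis
      using integrable_mult_indicator[OF PQ(1) integrable_product[OF that]]
        integrable_mult_indicator[OF PQ(2) integrable_product[OF that]] by simp
  qed
  have near: "norm (\<integral>t. indicator P t *\<^sub>R ?f x y t \<partial>nu) < e / 4"
    if xy: "x \<in> Y" "y \<in> Y" "\<delta> \<le> dist x y" and close: "dist x x0 < r / 2" "dist y y0 < r / 2" for x y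
  proof -
    have neq: "x \<noteq> y" using xy \<delta> by auto
    have sub: "t \<in> ball x (2 * r) \<union> ball y (2 * r)" if "t \<in> P" for t
      using that close r dist_triangle[of x t x0] dist_triangle[of y t y0] by (auto simp: P_def)
    have "ennreal (norm (\<integral>t. indicator P t *\<^sub>R ?f x y t \<partial>nu))
        \<le> (\<integral>\<^sup>+t. ennreal (norm (indicator P t *\<^sub>R ?f x y t)) \<partial>nu)"
      by (intro integral_norm_bound_ennreal integrable_mult_indicator PQ integrable_product xy neq)
    also have "\<dots> \<le> (\<integral>\<^sup>+t. ennreal (norm (?f x y t)) * indicator (ball x (2 * r) \<union> ball y (2 * r)) t \<partial>nu)"
      using sub by (intro nn_integral_mono) (auto simp: indicator_def)
    also have "\<dots> \<le> ennreal (\<eta> (2 * r))" using small xy r by simp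
    finally show ?thesis using \<eta>(2) r by simp
  qed
  have "\<forall>\<^sub>F n in sequentially. dist (X n) x0 < r / 2" "\<forall>\<^sub>F n in sequentially. dist (Z n) y0 < r / 2"
    using tendstoD[OF lim(1), of "r / 2"] tendstoD[OF lim(2), of "r / 2"] r by simp_all
  moreover have "\<forall>\<^sub>F n in sequentially. \<delta> < dist (X n) (Z n)"
    using tendsto_dist[OF lim] neq0 by (intro order_tendstoD(1)) (auto simp: \<delta>_def)
  ultimately have "\<forall>\<^sub>F n in sequentially. dist (X n) x0 < r / 2 \<and> dist (Z n) y0 < r / 2 \<and> \<delta> < dist (X n) (Z n)"
    by eventually_elim auto
  then obtain N where N: "\<And>n. N \<le> n \<Longrightarrow> dist (X n) x0 < r / 2"
      "\<And>n. N \<le> n \<Longrightarrow> dist (Z n) y0 < r / 2" "\<And>n. N \<le> n \<Longrightarrow> \<delta> < dist (X n) (Z n)"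
    unfolding eventually_sequentially by blast
  have "(\<lambda>n. \<integral>t. indicator Q t *\<^sub>R ?f (X (n + N)) (Z (n + N)) t \<partial>nu)
      \<longlonglongrightarrow> (\<integral>t. indicator Q t *\<^sub>R ?f x0 y0 t \<partial>nu)"
  \<comment> \<open>The shift by \<open>N\<close> makes the closeness hold for every index. On
    \<open>Q\<close> the moving poles are then at least \<open>r / 2\<close> from \<open>t\<close>,
    so a constant dominates; it is integrable as the measure is finite.\<close>
  proof (rule integral_dominated_convergence[where
        w = "\<lambda>_. M1 * M2 * ((r / 2) powr (-s) * (r / 2) powr (-u))"])
    show "integrable nu (\<lambda>_. M1 * M2 * ((r / 2) powr (-s) * (r / 2) powr (-u)))"
      using finite_measure_nu by (simp add: finite_measure.integrable_const)
    show "(\<lambda>t. indicator Q t *\<^sub>R ?f x0 y0 t) \<in> borel_measurable nu"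
      using PQ product_measurable[OF x0 y0] by simp
    show "(\<lambda>t. indicator Q t *\<^sub>R ?f (X (n + N)) (Z (n + N)) t) \<in> borel_measurable nu" for n
      using PQ product_measurable[OF XZ(1,2), of "n + N" "n + N"] by simp
    show "AE t in nu. (\<lambda>n. indicator Q t *\<^sub>R ?f (X (n + N)) (Z (n + N)) t)
        \<longlonglongrightarrow> indicator Q t *\<^sub>R ?f x0 y0 t"
    proof (rule AE_I2)
      fix t
      show "(\<lambda>n. indicator Q t *\<^sub>R ?f (X (n + N)) (Z (n + N)) t) \<longlonglongrightarrow> indicator Q t *\<^sub>R ?f x0 y0 t"
      proof (cases "t \<in> Q")
        case True
        then have "t \<in> Y" "t \<noteq> x0" "t \<noteq> y0" using r by (auto simp: Q_def)
        then have "(\<lambda>n. ?f (X n) (Z n) t) \<longlonglongrightarrow> ?f x0 y0 t"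
          using tendsto_product x0 y0 XZ lim by blast
        then have "(\<lambda>n. ?f (X (n + N)) (Z (n + N)) t) \<longlonglongrightarrow> ?f x0 y0 t"
          by (rule LIMSEQ_ignore_initial_segment)
        then show ?thesis using True by simp
      qed simp
    qed
    show "AE t in nu. norm (indicator Q t *\<^sub>R ?f (X (n + N)) (Z (n + N)) t)
        \<le> M1 * M2 * ((r / 2) powr (-s) * (r / 2) powr (-u))" for n
    proof (rule AE_I2)
      fix t
      let ?x = "X (n + N)" and ?z = "Z (n + N)"
      show "norm (indicator Q t *\<^sub>R ?f ?x ?z t) \<le> M1 * M2 * ((r / 2) powr (-s) * (r / 2) powr (-u))"
      proof (cases "t \<in> Q")
        case True
        then have t: "t \<in> Y" "r \<le> dist x0 t" "r \<le> dist y0 t" by (auto simp: Q_def)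
        then have d: "r / 2 \<le> dist ?x t" "r / 2 \<le> dist t ?z"
          using N(1)[of "n + N"] N(2)[of "n + N"] dist_triangle[of x0 t ?x] dist_triangle[of y0 t ?z]
          by (simp_all add: dist_commute)
        then have "t \<noteq> ?x" "t \<noteq> ?z" using r by auto
        then have "norm (?f ?x ?z t) \<le> M1 * M2 * w ?x ?z t"
          using norm_product_le XZ t by simp
        also have "\<dots> \<le> M1 * M2 * ((r / 2) powr (-s) * (r / 2) powr (-u))"
          using d r s u M1 M2 by (intro mult_left_mono mult_mono powr_neg_antimono) auto
        finally show ?thesis using True by simp
      qed (use M1 M2 in simp)
    qed
  qed
  then have limQ: "(\<lambda>n. \<integral>t. indicator Q t *\<^sub>R ?f (X n) (Z n) t \<partial>nu)
      \<longlonglongrightarrow> (\<integral>t. indicator Q t *\<^sub>R ?f x0 y0 t \<partial>nu)"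
    by (rule LIMSEQ_offset)
  obtain N' where N': "\<And>n. N' \<le> n \<Longrightarrow>
      dist (\<integral>t. indicator Q t *\<^sub>R ?f (X n) (Z n) t \<partial>nu) (\<integral>t. indicator Q t *\<^sub>R ?f x0 y0 t \<partial>nu) < e / 4"
    using metric_LIMSEQ_D[OF limQ, of "e / 4"] e by auto
  have near0: "norm (\<integral>t. indicator P t *\<^sub>R ?f x0 y0 t \<partial>nu) < e / 4"
    using x0 y0 r \<delta> by (intro near) (auto simp: \<delta>_def)
  \<comment> \<open>Three errors below \<open>e / 4\<close>: the two integrals over \<open>P\<close>
    and the difference of those over \<open>Q\<close>.\<close>
  show "\<exists>N. \<forall>n\<ge>N. dist (\<integral>t. ?f (X n) (Z n) t \<partial>nu) (\<integral>t. ?f x0 y0 t \<partial>nu) < e"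
  proof (intro exI allI impI)
    fix n assume n: "max N N' \<le> n"
    let ?a = "\<integral>t. indicator P t *\<^sub>R ?f (X n) (Z n) t \<partial>nu" and ?b = "\<integral>t. indicator P t *\<^sub>R ?f x0 y0 t \<partial>nu"
      and ?c = "\<integral>t. indicator Q t *\<^sub>R ?f (X n) (Z n) t \<partial>nu" and ?d = "\<integral>t. indicator Q t *\<^sub>R ?f x0 y0 t \<partial>nu"
    have "norm ?a < e / 4"
      using n XZ N(1)[of n] N(2)[of n] N(3)[of n] by (intro near) auto
    moreover have "norm (?c - ?d) < e / 4" using N'[of n] n by (simp add: dist_norm)
    moreover have "dist (?a + ?c) (?b + ?d) \<le> norm ?a + norm ?b + norm (?c - ?d)"
      unfolding dist_norm by norm
    ultimately have "dist (?a + ?c) (?b + ?d) < e" using near0 e by linarith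
    then show "dist (\<integral>t. ?f (X n) (Z n) t \<partial>nu) (\<integral>t. ?f x0 y0 t \<partial>nu) < e"
      using split XZ x0 y0 neq0 by simp
  qed
qed

lemma offdiag_continuous_integral_product:
  "offdiag_continuous Y (\<lambda>x y. \<integral>t. K1 x t * K2 t y \<partial>nu)"
  unfolding offdiag_continuous_def continuous_on_sequentially
proof (intro allI ballI impI, elim conjE)
  fix p :: "nat \<Rightarrow> 'a \<times> 'a" and z
  assume z: "z \<in> {(x, y). x \<in> Y \<and> y \<in> Y \<and> x \<noteq> y}"
    and p: "\<forall>n. p n \<in> {(x, y). x \<in> Y \<and> y \<in> Y \<and> x \<noteq> y}" and lim: "p \<longlonglongrightarrow> z"
  have "(\<lambda>n. \<integral>t. K1 (fst (p n)) t * K2 t (snd (p n)) \<partial>nu)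
      \<longlonglongrightarrow> (\<integral>t. K1 (fst z) t * K2 t (snd z) \<partial>nu)"
    using z p tendsto_fst[OF lim] tendsto_snd[OF lim]
    by (intro tendsto_integral_product) (auto simp: case_prod_beta)
  then show "((\<lambda>(x, y). \<integral>t. K1 x t * K2 t y \<partial>nu) \<circ> p)
      \<longlonglongrightarrow> (case z of (x, y) \<Rightarrow> \<integral>t. K1 x t * K2 t y \<partial>nu)"
    by (simp add: o_def case_prod_beta)
qed

end

section \<open>Removing the radius threshold, and the theorem\<close>

text \<open>For radii \<open>r \<ge> \<rho>\<close> the total mass is enough, since it is at most
  \<open>measure nu Y / \<rho> powr v * r powr v\<close>. Adding that coefficient to
  \<open>c0\<close> covers all radii.\<close>

lemma ex_bounded_ahlfors:
  fixes Y :: "'a::metric_space set"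
  assumes bdd: "bounded Y" and space_nu: "space nu = Y"
    and borel_sub: "sets (restrict_space borel Y) \<subseteq> sets nu"
    and fin_balls: "\<And>x r. x \<in> Y \<Longrightarrow> 0 < r \<Longrightarrow> emeasure nu (ball x r \<inter> Y) < \<infinity>"
    and v_pos: "0 < v" and ahlfors: "upper_ahlfors_regular nu Y v"
  obtains c D where "bounded_ahlfors Y nu v c D"
proof -
  obtain e where e: "\<And>x y. x \<in> Y \<Longrightarrow> y \<in> Y \<Longrightarrow> dist x y \<le> e"
    using bdd unfolding bounded_two_points by blast
  obtain r0 c0 where c0: "0 < r0" "0 < c0" and ball: "\<And>x r. x \<in> Y \<Longrightarrow> 0 < r \<Longrightarrow> ereal r < r0 \<Longrightarrow>
      emeasure nu (ball x r \<inter> Y) \<le> ennreal (c0 * r powr v)"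
    using ahlfors unfolding upper_ahlfors_regular_def by blast
  \<comment> \<open>\<open>r0\<close> may be infinite, so a finite threshold below it is
    fixed.\<close>
  obtain \<rho> where \<rho>: "0 < \<rho>" "ereal \<rho> < r0"
    using ereal_dense2[OF c0(1)] by auto
  have "emeasure nu Y < \<infinity>"
  proof (cases "Y = {}")
    case False
    then obtain x where x: "x \<in> Y" by auto
    have "ball x (\<bar>e\<bar> + 1) \<inter> Y = Y" using e[OF x] by force
    then show ?thesis using fin_balls[OF x, of "\<bar>e\<bar> + 1"] by simp
  qed simp
  then have T: "emeasure nu Y = ennreal (measure nu Y)"
    by (intro emeasure_eq_ennreal_measure) auto
  have "bounded_ahlfors Y nu v (c0 + measure nu Y / \<rho> powr v) (max 1 e)"
  proof
    show "0 < c0 + measure nu Y / \<rho> powr v" using c0 by (simp add: add_pos_nonneg)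
    show "dist x y \<le> max 1 e" if "x \<in> Y" "y \<in> Y" for x y using e[OF that] by simp
    fix x and r :: real assume x: "x \<in> Y" and r: "0 < r"
    show "emeasure nu (ball x r \<inter> Y) \<le> ennreal ((c0 + measure nu Y / \<rho> powr v) * r powr v)"
    proof (cases "r < \<rho>")
      case True
      then have "ereal r < r0" using \<rho>(2) by (meson ereal_less(2) less_ereal.simps(1) less_trans)
      then have "emeasure nu (ball x r \<inter> Y) \<le> ennreal (c0 * r powr v)" using ball x r by blast
      also have "\<dots> \<le> ennreal ((c0 + measure nu Y / \<rho> powr v) * r powr v)"
        by (intro ennreal_leI mult_right_mono) auto
      finally show ?thesis .
    next
      case False
      have "emeasure nu (ball x r \<inter> Y) \<le> ennreal (measure nu Y)"
        using emeasure_space[of nu] T by (simp add: space_nu)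
      also have "\<dots> \<le> ennreal ((c0 + measure nu Y / \<rho> powr v) * r powr v)"
      proof (rule ennreal_leI)
        have "measure nu Y * \<rho> powr v \<le> measure nu Y * r powr v"
          using False \<rho> v_pos by (intro mult_left_mono powr_mono2) auto
        then have "measure nu Y \<le> measure nu Y / \<rho> powr v * r powr v"
          using \<rho> by (simp add: field_simps)
        also have "\<dots> \<le> (c0 + measure nu Y / \<rho> powr v) * r powr v"
          using c0 by (intro mult_right_mono) auto
        finally show "measure nu Y \<le> (c0 + measure nu Y / \<rho> powr v) * r powr v" .
      qed
      finally show ?thesis .
    qed
  qed (use space_nu borel_sub v_pos in auto)
  then show thesis by (rule that)
qed

text \<open>Integrability is part of the conclusion because the Bochner integral of a non-integrable
  function is 0 by convention; class membership alone would not show that the integral defining the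
  kernel exists.\<close>

theorem theorem4p6:
  fixes Y :: "'a::metric_space set"
    and nu :: "'a measure"
    and v s1 t1 s3 s2' s2'' s2 :: real
    and K1 K2 :: "'a \<Rightarrow> 'a \<Rightarrow> complex"
  assumes bdd: "bounded Y"
    and space_nu: "space nu = Y"
    and borel_sub: "sets (restrict_space borel Y) \<subseteq> sets nu"
    and fin_balls: "\<And>x r. x \<in> Y \<Longrightarrow> 0 < r \<Longrightarrow> emeasure nu (ball x r \<inter> Y) < \<infinity>"
    and v_pos: "0 < v"
    and ahlfors: "upper_ahlfors_regular nu Y v"
    and s1: "0 \<le> s1" "s1 < v"
    and t1: "0 \<le> t1" "t1 < v"
    and s3: "0 \<le> s3"
    and s2': "0 \<le> s2'" "s2' < v"
    and s2'': "0 \<le> s2''" "s2'' \<le> s3"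
    and s2_def: "s2 = s2' + s2''"
    and strong: "s1 + t1 = v \<or> s2' + t1 = v \<Longrightarrow> strongly_upper_ahlfors_regular nu Y v"
    and K1: "K1 \<in> kernel_class3 Y s1 s2 s3"
    and K2: "K2 \<in> kernel_class Y t1"
  shows "(\<forall>x\<in>Y. \<forall>y\<in>Y. x \<noteq> y \<longrightarrow> integrable nu (\<lambda>t. K1 x t * K2 t y)) \<and>
    (\<forall>\<epsilon>::real. 0 < \<epsilon> \<longrightarrow>
      (let m = min (s3 - s2'') (min (v - s1) (v - t1));
           a1 = (if s1 + t1 < v then 0 else if s1 + t1 = v then \<epsilon> else s1 + t1 - v);
           a2 = (if s2' + t1 < v then max s1 t1
                 else if s2' + t1 = v then max \<epsilon> (max s1 t1)
                 else max (s2' + t1 - v) (max s1 t1))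
       in (\<lambda>x y. \<integral>t. K1 x t * K2 t y \<partial>nu) \<in> kernel_class3 Y a1 a2 m))"
proof -
  obtain c D where "bounded_ahlfors Y nu v c D"
    using ex_bounded_ahlfors[OF bdd space_nu borel_sub fin_balls v_pos ahlfors] by blast
  then interpret bounded_ahlfors Y nu v c D .
  note K1_props = K1[unfolded kernel_class3_def, THEN CollectD]
  from K1_props[THEN conjunct2, THEN conjunct1]
  obtain C1 where C1: "\<And>x y. x \<in> Y \<Longrightarrow> y \<in> Y \<Longrightarrow> x \<noteq> y \<Longrightarrow> dist x y powr s1 * norm (K1 x y) \<le> C1"
    by auto
  from K2[unfolded kernel_class_def, THEN CollectD, THEN conjunct2]
  obtain C2 where C2: "\<And>x y. x \<in> Y \<Longrightarrow> y \<in> Y \<Longrightarrow> x \<noteq> y \<Longrightarrow> norm (K2 x y) * dist x y powr t1 \<le> C2"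
    by auto
  from K1_props[THEN conjunct2, THEN conjunct2]
  obtain C3 where C3: "\<And>x' x'' y. x' \<in> Y \<Longrightarrow> x'' \<in> Y \<Longrightarrow> y \<in> Y \<Longrightarrow> x' \<noteq> x'' \<Longrightarrow>
      y \<notin> ball x' (2 * dist x' x'') \<Longrightarrow>
      dist x' y powr s2 / dist x' x'' powr s3 * norm (K1 x' y - K1 x'' y) \<le> C3"
    by (elim exE) metis
  \<comment> \<open>The class bounds are mere upper bounds and may be negative when no admissible
    points exist, hence the absolute values here and in the interpretation below.\<close>
  have holder: "norm (K1 x' t - K1 x'' t) \<le> \<bar>C3\<bar> * dist x' x'' powr s3 * dist x' t powr (-(s2' + s2''))"
    if "x' \<in> Y" "x'' \<in> Y" "t \<in> Y" "x' \<noteq> x''" "t \<notin> ball x' (2 * dist x' x'')" for x' x'' t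
  proof -
    have "0 < dist x' x''" using that by simp
    with that(5) have pos: "0 < dist x' t" by (auto simp del: zero_less_dist_iff)
    have "dist x' t powr s2 / dist x' x'' powr s3 * norm (K1 x' t - K1 x'' t) \<le> \<bar>C3\<bar>"
      using C3[OF that] by simp
    with pos \<open>0 < dist x' x''\<close> show ?thesis
      unfolding s2_def[symmetric] powr_minus by (simp add: field_simps)
  qed
  interpret composable_kernels Y nu v c D K1 K2 s1 t1 "\<bar>C1\<bar>" "\<bar>C2\<bar>"
  proof
    show "offdiag_continuous Y K1" "offdiag_continuous Y K2"
      using K1 K2 by (auto simp: kernel_class3_def kernel_class_def)
    show "norm (K1 x t) \<le> \<bar>C1\<bar> * dist x t powr (-s1)" if "x \<in> Y" "t \<in> Y" "x \<noteq> t" for x t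
      using C1[OF that] that by (simp add: powr_minus field_simps)
    show "norm (K2 t y) \<le> \<bar>C2\<bar> * dist t y powr (-t1)" if "t \<in> Y" "y \<in> Y" "t \<noteq> y" for t y
      using C2[OF that] that by (simp add: powr_minus field_simps)
  qed (use s1 t1 in auto)
  show ?thesis
    unfolding Let_def
  proof (intro conjI ballI allI impI)
    fix x y assume "x \<in> Y" "y \<in> Y" "x \<noteq> y"
    then show "integrable nu (\<lambda>t. K1 x t * K2 t y)" by (rule integrable_product)
  next
    fix \<epsilon> :: real assume \<epsilon>: "0 < \<epsilon>"
    define a1 where "a1 = (if s1 + t1 < v then 0 else if s1 + t1 = v then \<epsilon> else s1 + t1 - v)"
    define a2 where "a2 = (if s2' + t1 < v then max s1 t1
                 else if s2' + t1 = v then max \<epsilon> (max s1 t1)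
                 else max (s2' + t1 - v) (max s1 t1))"
    define m where "m = min (s3 - s2'') (min (v - s1) (v - t1))"
    have "(\<lambda>x y. \<integral>t. K1 x t * K2 t y \<partial>nu) \<in> kernel_class3 Y a1 a2 m"
      unfolding kernel_class3_def
    proof (intro CollectI conjI)
      show "offdiag_continuous Y (\<lambda>x y. \<integral>t. K1 x t * K2 t y \<partial>nu)"
        by (rule offdiag_continuous_integral_product)
      show "\<exists>C. \<forall>x\<in>Y. \<forall>y\<in>Y. x \<noteq> y \<longrightarrow> dist x y powr a1 * norm (\<integral>t. K1 x t * K2 t y \<partial>nu) \<le> C"
        using \<epsilon> by (intro norm_integral_product_le) (auto simp: a1_def)
      show "\<exists>C. \<forall>x'\<in>Y. \<forall>x''\<in>Y. \<forall>y\<in>Y. x' \<noteq> x'' \<and> y \<notin> ball x' (2 * dist x' x'') \<longrightarrow>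
         dist x' y powr a2 / dist x' x'' powr m *
         norm ((\<integral>t. K1 x' t * K2 t y \<partial>nu) - (\<integral>t. K1 x'' t * K2 t y \<partial>nu)) \<le> C"
        \<comment> \<open>The splitting of \<open>s2\<close> gives \<open>p = s2'\<close>, the part
          kept in the integral, and \<open>q = s2''\<close>, the part traded for a power of
          \<open>dist x' x''\<close>.\<close>
        by (rule norm_integral_product_diff_le[OF holder _ s2' s2''])
          (use \<epsilon> s1 t1 in \<open>auto simp: a2_def m_def\<close>)
    qed
    then show "(\<lambda>x y. \<integral>t. K1 x t * K2 t y \<partial>nu)
        \<in> kernel_class3 Y (if s1 + t1 < v then 0 else if s1 + t1 = v then \<epsilon> else s1 + t1 - v)
           (if s2' + t1 < v then max s1 t1
            else if s2' + t1 = v then max \<epsilon> (max s1 t1)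
            else max (s2' + t1 - v) (max s1 t1))
           (min (s3 - s2'') (min (v - s1) (v - t1)))"
      unfolding a1_def a2_def m_def .
  qed
qed

end
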